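(* Let $T>0$ and let $C:[0,T]\times\mathbb{R}^n\rightrightarrows\mathbb{R}^n$ have non-empty closed convex values and satisfy, for some constants $L_1\ge0$ and $0\le L_2<1$, $$d_H(C(t,x),C(s,y))\le L_1|t-s|+L_2\|x-y\|\quad\text{for all } t,s\in[0,T],\ x,y\in\mathbb{R}^n.$$ Let $f:[0,T]\times\mathbb{R}^n\to\mathbb{R}^n$ be continuous with $\|f(t,x)\|\le c_f(1+\|x\|)$ for all $(t,x)\in[0,T]\times\mathbb{R}^n$, for some $c_f>0$. Suppose that for every $M>0$ there exist $k_M,l_M>0$ such that for all $t\in[0,T]$ and all $x_1,x_2\in\mathbb{R}^n$ with $\|x_i\|\le M$: $$\langle x_1^*-x_2^*,x_1-x_2\rangle\ge-k_M\|x_1-x_2\|^2\quad\text{whenever } x_i^*\in N_{C(t,x_i)}(x_i),\ i=1,2,$$ and $\|f(t,x_1)-f(t,x_2)\|\le l_M\|x_1-x_2\|$. Then for each $t_0\in[0,T]$ and each $x_0\in C(t_0,x_0)$, the differential inclusion $$\dot x(t)\in f(t,x(t))-N_{C(t,x(t))}(x(t))\ \text{ for a.e. } t\in[t_0,T],\qquad x(t_0)=x_0,$$ has a unique solution on $[t_0,T]$.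
   Context: For closed convex sets $K_1,K_2$, $d_H(K_1,K_2)=\max\{\sup_{x_1\in K_1}d(x_1,K_2),\sup_{x_2\in K_2}d(x_2,K_1)\}$ is the Hausdorff distance. For a closed convex $K$, $N_K(x)=\{x^*:\langle x^*,y-x\rangle\le0\ \forall y\in K\}$ if $x\in K$ and $N_K(x)=\emptyset$ if $x\notin K$. A solution is an absolutely continuous function $x:[t_0,T]\to\mathbb{R}^n$ with $x(t_0)=x_0$ satisfying the inclusion for almost every $t$. *)

theory Defs
  imports "HOL-Analysis.Analysis"
begin

(* Extended-real valued, since the distance between unbounded sets may be infinite;
   a real supremum would be unspecified there. Intended for non-empty sets:
   infdist x {} = 0. *)
definition hausdorff_dist :: "'a::metric_space set \<Rightarrow> 'a set \<Rightarrow> ereal" where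
  "hausdorff_dist K1 K2 =
     max (SUP x\<in>K1. ereal (infdist x K2)) (SUP x\<in>K2. ereal (infdist x K1))"

definition normal_cone :: "'a::real_inner set \<Rightarrow> 'a \<Rightarrow> 'a set" where
  "normal_cone K x = (if x \<in> K then {z. \<forall>y\<in>K. inner z (y - x) \<le> 0} else {})"

definition absolutely_continuous_on_interval ::
  "real \<Rightarrow> real \<Rightarrow> (real \<Rightarrow> 'a::real_normed_vector) \<Rightarrow> bool" where
  "absolutely_continuous_on_interval u v x \<longleftrightarrow>
     (\<forall>\<epsilon>>0. \<exists>\<delta>>0. \<forall>(n::nat) a b.
        (\<forall>i<n. u \<le> a i \<and> a i \<le> b i \<and> b i \<le> v) \<and>
        disjoint_family_on (\<lambda>i. {a i<..<b i}) {..<n} \<and>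
        (\<Sum>i<n. b i - a i) < \<delta> \<longrightarrow>
        (\<Sum>i<n. norm (x (b i) - x (a i))) < \<epsilon>)"

(* Only the values of x on {t0..T} matter: the derivative is taken within {t0..T}. *)
definition inclusion_solution ::
  "(real \<Rightarrow> 'a \<Rightarrow> 'a set) \<Rightarrow> real \<Rightarrow> real \<Rightarrow> 'a \<Rightarrow> (real \<Rightarrow> 'a::real_normed_vector) \<Rightarrow> bool" where
  "inclusion_solution F t0 T x0 x \<longleftrightarrow>
     absolutely_continuous_on_interval t0 T x \<and> x t0 = x0 \<and>
     (AE t in lebesgue_on {t0..T}.
        \<exists>v. (x has_vector_derivative v) (at t within {t0..T}) \<and> v \<in> F t (x t))"

end

theory Submission
  imports Defs
begin

text \<open>The normal cones are cones, so the hypomonotonicity assumption forces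
  \<open>x \<mapsto> N\<^bsub>C(t,x)\<^esub>(x)\<close> to be monotone. Since \<open>L2 < 1\<close>, Brouwer's theorem solves
  \<open>p = proj\<^bsub>C(t,p)\<^esub>(y)\<close> for every \<open>y\<close>, so the operator is maximal monotone and cone-valued; hence it is the normal
  cone of its domain \<open>D(t) = {x. x \<in> C(t,x)}\<close>, which is closed, convex, and Lipschitz in \<open>t\<close> with
  constant \<open>L1 / (1 - L2)\<close>. The state-dependent problem thus becomes the sweeping process of
  the sets \<open>D(t)\<close>. Its catching-up approximations are uniformly Lipschitz up to the mesh size, a pointwise
  cluster point is Lipschitz, hence differentiable almost everywhere, and passing to the limit in the
  summed projection inequalities gives the inclusion at every point of differentiability.
  Uniqueness is Gronwall's argument for \<open>\<parallel>x - y\<parallel>\<^sup>2\<close>.\<close>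

section \<open>Implicit projections\<close>

text \<open>Why Brouwer and not Banach: even for L2 < 1 the map sending p to the projection of y
  onto C(t,p) need not be a contraction, because the projection depends on the set only like the
  square root of the Hausdorff distance. The fixed point p comes with the bound |y - p| <= d(y,
  C(t,y)) / (1 - L2). For y in D(s) the distance on the right is at most L1 |t - s|, since both sets
  are taken at the same state y; this is where L1 / (1 - L2) comes from. The difficulty in the limit
  is that the velocities of the approximations need not converge. The projection inequalities of
  successive steps also have different base points and different sets. Replacing these by one fixed
  point and one fixed set costs an error that is small compared with the length of the time
  interval, so it disappears after division by that length. What survives is an inequality between
  difference quotients, which requires the curve alone to converge.\<close>

lemma hausdorff_dist_le_ereal_iff:
  "hausdorff_dist A B \<le> ereal r \<longleftrightarrow>
     (\<forall>x\<in>A. infdist x B \<le> r) \<and> (\<forall>x\<in>B. infdist x A \<le> r)"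
  by (simp add: hausdorff_dist_def SUP_le_iff)

lemma hausdorff_dist_commute: "hausdorff_dist A B = hausdorff_dist B A"
  by (simp add: hausdorff_dist_def max.commute)

lemma hausdorff_dist_le_obtain_close:
  fixes A B :: "'a::heine_borel set"
  assumes "hausdorff_dist A B \<le> ereal r" "closed B" "B \<noteq> {}" "x \<in> A"
  obtains y where "y \<in> B" "dist x y \<le> r"
  using assms infdist_attains_inf[of B x] by (metis hausdorff_dist_le_ereal_iff)

lemma infdist_closest_point:
  assumes "closed A" "A \<noteq> {}"
  shows "infdist x A = dist x (closest_point A x)"
  using setdist_closest_point[OF assms] by (simp add: infdist_eq_setdist)

lemma infdist_le_hausdorff_dist:
  fixes A B :: "'a::euclidean_space set"
  assumes H: "hausdorff_dist A B \<le> ereal r" and A: "closed A" "A \<noteq> {}" and B: "closed B" "B \<noteq> {}"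
  shows "infdist y B \<le> infdist y A + r"
proof -
  have "closest_point A y \<in> A" using A by (rule closest_point_in_set)
  then obtain q where q: "q \<in> B" "dist (closest_point A y) q \<le> r"
    using hausdorff_dist_le_obtain_close[OF H B] by blast
  have "infdist y B \<le> dist y q" using q(1) by (rule infdist_le)
  also have "\<dots> \<le> dist y (closest_point A y) + dist (closest_point A y) q" by (rule dist_triangle)
  finally show ?thesis using q(2) infdist_closest_point[OF A] by simp
qed

text \<open>Test the variational inequality of each projection with a point of its own set within
  \<open>r\<close> of the other projection, and add the two. Only the square of the distance is
  controlled by \<open>r\<close>, hence a dependence of order 1/2 on the set.\<close>

lemma dist_closest_point_hausdorff:
  fixes A B :: "'a::euclidean_space set"
  assumes H: "hausdorff_dist A B \<le> ereal r"
    and A: "closed A" "A \<noteq> {}" "convex A" and B: "closed B" "B \<noteq> {}" "convex B"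
  shows "(dist (closest_point A y) (closest_point B y))\<^sup>2 \<le> r * (infdist y A + infdist y B)"
proof -
  have *: "inner (y - closest_point B y) (closest_point A y - closest_point B y) \<le> r * infdist y B"
    if H: "hausdorff_dist A B \<le> ereal r"
      and A: "closed A" "A \<noteq> {}" and B: "closed B" "B \<noteq> {}" "convex B" for A B :: "'a set"
  proof -
    have "closest_point A y \<in> A" using A by (rule closest_point_in_set)
    then obtain q where q: "q \<in> B" "dist (closest_point A y) q \<le> r"
      using hausdorff_dist_le_obtain_close[OF H B(1,2)] by blast
    let ?v = "y - closest_point B y"
    have "inner ?v (q - closest_point B y) \<le> 0"
      using closest_point_dot[OF B(3,1) q(1)] .
    moreover have "inner ?v (closest_point A y - q) \<le> norm ?v * norm (closest_point A y - q)"
      by (rule norm_cauchy_schwarz)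
    moreover have "\<dots> \<le> norm ?v * r"
      using q(2) by (intro mult_left_mono) (auto simp: dist_norm)
    moreover have "inner ?v (closest_point A y - closest_point B y)
        = inner ?v (closest_point A y - q) + inner ?v (q - closest_point B y)"
      by (simp add: inner_diff_right)
    ultimately show ?thesis
      by (simp add: infdist_closest_point[OF B(1,2)] dist_norm mult.commute)
  qed
  have "(dist (closest_point A y) (closest_point B y))\<^sup>2
      = inner (y - closest_point B y) (closest_point A y - closest_point B y)
      + inner (y - closest_point A y) (closest_point B y - closest_point A y)"
    by (simp add: dist_norm power2_norm_eq_inner inner_diff inner_commute algebra_simps)
  also have "\<dots> \<le> r * infdist y B + r * infdist y A"
    using *[OF H A(1,2) B] *[OF _ B(1,2) A] H by (simp add: hausdorff_dist_commute)
  finally show ?thesis by (simp add: algebra_simps)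
qed

lemma closest_point_normal_cone:
  assumes "closed A" "A \<noteq> {}" "convex A"
  shows "y - closest_point A y \<in> normal_cone A (closest_point A y)"
  using assms closest_point_in_set closest_point_dot by (auto simp: normal_cone_def)

text \<open>\<open>p\<close> is a fixed point of \<open>x |-> closest_point (K x) y\<close>, whose
  continuity on a ball is the square-root estimate with both distances bounded. The bound on
  \<open>y - p\<close> later compares fixed sets at different times.\<close>

lemma exists_implicit_projection:
  fixes K :: "'a::euclidean_space \<Rightarrow> 'a set"
  assumes K: "\<And>x. closed (K x)" "\<And>x. K x \<noteq> {}" "\<And>x. convex (K x)"
    and H: "\<And>x y. hausdorff_dist (K x) (K y) \<le> ereal (L * norm (x - y))"
    and L: "0 \<le> L" "L < 1"
  obtains p where "p \<in> K p" "y - p \<in> normal_cone (K p) p" "norm (y - p) \<le> infdist y (K y) / (1 - L)"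
proof -
  \<comment> \<open>\<open>R\<close> solves \<open>infdist y (K y) + L * R = R\<close>, which is
    what makes the ball of radius \<open>R\<close> about \<open>y\<close> invariant.\<close>
  define R where "R = infdist y (K y) / (1 - L)"
  have R: "0 \<le> R" "infdist y (K y) + L * R = R"
    using L by (auto simp: R_def infdist_nonneg field_simps)
  have d: "infdist y (K x) \<le> R" if "x \<in> cball y R" for x
  proof -
    have "infdist y (K x) \<le> infdist y (K y) + L * norm (y - x)"
      using infdist_le_hausdorff_dist[OF H] K by blast
    also have "\<dots> \<le> infdist y (K y) + L * R"
      using that L by (intro add_left_mono mult_left_mono) (auto simp: dist_norm)
    finally show ?thesis using R by simp
  qed
  have "\<exists>\<delta>>0. \<forall>x'\<in>cball y R. dist x' x < \<delta> \<longrightarrow> dist (closest_point (K x') y) (closest_point (K x) y) < e"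
    if x: "x \<in> cball y R" and e: "e > 0" for x e
  proof (intro exI conjI ballI impI)
    show "e\<^sup>2 / (2 * R + 1) > 0" using e R by simp
    fix x' assume x': "x' \<in> cball y R" "dist x' x < e\<^sup>2 / (2 * R + 1)"
    have "(dist (closest_point (K x') y) (closest_point (K x) y))\<^sup>2
        \<le> (L * norm (x' - x)) * (infdist y (K x') + infdist y (K x))"
      using dist_closest_point_hausdorff[OF H] K by blast
    \<comment> \<open>Both distances are at most \<open>R\<close>; the summand 1 keeps the chosen
      delta meaningful when \<open>R = 0\<close>.\<close>
    also have "\<dots> \<le> norm (x' - x) * (2 * R + 1)"
      using d[OF x] d[OF x'(1)] L R(1)
      by (intro mult_mono) (auto simp: mult_left_le_one_le infdist_nonneg)
    also have "\<dots> < e\<^sup>2" using x'(2) R(1) by (simp add: dist_norm field_simps)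
    finally show "dist (closest_point (K x') y) (closest_point (K x) y) < e"
      using e by (simp add: power2_less_imp_less)
  qed
  then have cont: "continuous_on (cball y R) (\<lambda>x. closest_point (K x) y)"
    unfolding continuous_on_iff by blast
  have maps: "(\<lambda>x. closest_point (K x) y) \<in> cball y R \<rightarrow> cball y R"
    using d infdist_closest_point[OF K(1,2)] by auto
  obtain p where "p \<in> cball y R" "closest_point (K p) y = p"
    using brouwer[OF compact_cball convex_cball _ cont maps] R(1) by auto
  then show thesis
    using that[of p] closest_point_in_set[OF K(1,2)] closest_point_normal_cone[OF K, of y p]
    by (simp add: dist_norm R_def) metis
qed

section \<open>Monotone families of normal cones and their fixed sets\<close>

lemma normal_cone_scaleR: "z \<in> normal_cone K x \<Longrightarrow> 0 \<le> c \<Longrightarrow> c *\<^sub>R z \<in> normal_cone K x"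
  by (auto simp: normal_cone_def mult_nonneg_nonpos split: if_splits)

lemma zero_in_normal_cone: "x \<in> K \<Longrightarrow> 0 \<in> normal_cone K x"
  by (simp add: normal_cone_def)

text \<open>Normal vectors can be scaled up, so that the quadratic defect becomes negligible.\<close>

lemma monotone_normal_cone_if_hypomonotone:
  assumes "\<And>z1 z2. z1 \<in> normal_cone K1 x1 \<Longrightarrow> z2 \<in> normal_cone K2 x2 \<Longrightarrow>
        inner (z1 - z2) (x1 - x2) \<ge> - k * (norm (x1 - x2))\<^sup>2"
    and z: "z1 \<in> normal_cone K1 x1" "z2 \<in> normal_cone K2 x2"
  shows "inner (z1 - z2) (x1 - x2) \<ge> 0"
proof -
  have *: "inner (z1 - z2) (x1 - x2) \<ge> - (\<bar>k * (norm (x1 - x2))\<^sup>2\<bar> / c)" if "c > 0" for c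
  proof -
    have "inner (c *\<^sub>R z1 - c *\<^sub>R z2) (x1 - x2) \<ge> - k * (norm (x1 - x2))\<^sup>2"
      using that by (intro assms normal_cone_scaleR z) auto
    then have "c * inner (z1 - z2) (x1 - x2) \<ge> - \<bar>k * (norm (x1 - x2))\<^sup>2\<bar>"
      by (simp flip: scaleR_diff_right)
    then show ?thesis using that by (simp add: field_simps)
  qed
  have "((\<lambda>c. - (\<bar>k * (norm (x1 - x2))\<^sup>2\<bar> / c)) \<longlongrightarrow> 0) at_top"
    using tendsto_minus[OF tendsto_divide_0[OF tendsto_const filterlim_at_top_imp_at_infinity[OF filterlim_ident]]]
    by simp
  then show ?thesis
    by (rule tendsto_upperbound) (auto intro!: eventually_mono[OF eventually_gt_at_top[of 0]] *)
qed

text \<open>The domain of \<open>x |-> normal_cone (K x) x\<close>, as cones are empty off their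
  set; for \<open>K = C t\<close> it is the set \<open>D(t)\<close> of the overview.\<close>

definition fixed_set :: "('a \<Rightarrow> 'a set) \<Rightarrow> 'a set" where "fixed_set K = {x. x \<in> K x}"

text \<open>\<open>resolvent\<close> is Minty's form of maximality: the identity plus the monotone
  map is onto.\<close>

locale monotone_normals =
  fixes K :: "'a::euclidean_space \<Rightarrow> 'a set"
  assumes monotone: "\<And>x1 x2 z1 z2. z1 \<in> normal_cone (K x1) x1 \<Longrightarrow> z2 \<in> normal_cone (K x2) x2 \<Longrightarrow>
      inner (z1 - z2) (x1 - x2) \<ge> 0"
    and resolvent: "\<And>y. \<exists>p. y - p \<in> normal_cone (K p) p"
begin

text \<open>The zero vector is normal at every point of the fixed set, so monotonicity against it
  gives one direction. Conversely, resolve \<open>x + z\<close> to a point \<open>p\<close>: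
  monotonicity against the zero normal at \<open>x\<close>, together with the assumed inequality at
  \<open>p\<close>, leaves a nonpositive squared norm of \<open>p - x\<close>, so
  \<open>p = x\<close>.\<close>

lemma normal_cone_iff:
  assumes x: "x \<in> fixed_set K"
  shows "z \<in> normal_cone (K x) x \<longleftrightarrow> (\<forall>y\<in>fixed_set K. inner z (y - x) \<le> 0)"
proof
  assume "z \<in> normal_cone (K x) x"
  then have "inner (z - 0) (x - y) \<ge> 0" if "y \<in> fixed_set K" for y
    using that by (intro monotone zero_in_normal_cone) (auto simp: fixed_set_def)
  then show "\<forall>y\<in>fixed_set K. inner z (y - x) \<le> 0"
    by (simp add: inner_diff_right)
next
  assume *: "\<forall>y\<in>fixed_set K. inner z (y - x) \<le> 0"
  obtain p where p: "(x + z) - p \<in> normal_cone (K p) p" using resolvent by blast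
  then have "p \<in> fixed_set K" by (auto simp: normal_cone_def fixed_set_def split: if_splits)
  with * have "inner z (p - x) \<le> 0" by blast
  moreover have "inner ((x + z) - p - 0) (p - x) \<ge> 0"
    using x p by (intro monotone zero_in_normal_cone) (auto simp: fixed_set_def)
  ultimately have "inner (p - x) (p - x) \<le> 0"
    by (simp add: inner_diff inner_add inner_commute)
  then have "p = x" by (metis inner_gt_zero_iff not_less eq_iff_diff_eq_0)
  with p show "z \<in> normal_cone (K x) x" by simp
qed

text \<open>The point \<open>p\<close> that resolves \<open>w\<close> satisfies these inequalities
  for all \<open>y\<close> in the fixed set; if they extend to \<open>y = w\<close>, then
  \<open>p = w\<close>. Closedness and convexity follow, since a closed half-space containing the
  fixed set also contains its limits and convex combinations.\<close>

lemma fixed_setI: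
  assumes "\<And>p. p \<in> fixed_set K \<Longrightarrow> (\<And>y. y \<in> fixed_set K \<Longrightarrow> inner (w - p) (y - p) \<le> 0) \<Longrightarrow> inner (w - p) (w - p) \<le> 0"
  shows "w \<in> fixed_set K"
proof -
  obtain p where p: "w - p \<in> normal_cone (K p) p" using resolvent by blast
  then have pf: "p \<in> fixed_set K" by (auto simp: normal_cone_def fixed_set_def split: if_splits)
  with p normal_cone_iff have "inner (w - p) (y - p) \<le> 0" if "y \<in> fixed_set K" for y
    using that by blast
  with pf assms have "inner (w - p) (w - p) \<le> 0" by blast
  then have "w = p" by (metis inner_gt_zero_iff not_less eq_iff_diff_eq_0)
  with pf show ?thesis by simp
qed

lemma closed_fixed_set: "closed (fixed_set K)"
proof -
  have "w \<in> fixed_set K" if "w \<in> closure (fixed_set K)" for w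
  proof (rule fixed_setI)
    fix p assume "\<And>y. y \<in> fixed_set K \<Longrightarrow> inner (w - p) (y - p) \<le> 0"
    then have "closure (fixed_set K) \<subseteq> {y. inner (w - p) (y - p) \<le> 0}"
      by (intro closure_minimal closed_Collect_le continuous_intros) auto
    with that show "inner (w - p) (w - p) \<le> 0" by blast
  qed
  then show ?thesis using closure_subset_eq by blast
qed

lemma convex_fixed_set: "convex (fixed_set K)"
proof (rule convexI)
  fix x y :: 'a and u v :: real
  assume xy: "x \<in> fixed_set K" "y \<in> fixed_set K" and uv: "0 \<le> u" "0 \<le> v" "u + v = 1"
  let ?w = "u *\<^sub>R x + v *\<^sub>R y"
  show "?w \<in> fixed_set K"
  proof (rule fixed_setI)
    fix p assume p: "\<And>y. y \<in> fixed_set K \<Longrightarrow> inner (?w - p) (y - p) \<le> 0"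
    have "?w - p = u *\<^sub>R (x - p) + v *\<^sub>R (y - p)"
      using uv(3) by (simp add: algebra_simps flip: scaleR_add_left)
    then have "inner (?w - p) (?w - p) = u * inner (?w - p) (x - p) + v * inner (?w - p) (y - p)"
      by (metis inner_add_right inner_scaleR_right)
    also have "\<dots> \<le> 0"
      using p[OF xy(1)] p[OF xy(2)] uv by (intro add_nonpos_nonpos mult_nonneg_nonpos)
    finally show "inner (?w - p) (?w - p) \<le> 0" .
  qed
qed

lemma fixed_set_nonempty: "fixed_set K \<noteq> {}"
proof -
  obtain p where "0 - p \<in> normal_cone (K p) p" using resolvent by blast
  then have "p \<in> fixed_set K" by (auto simp: normal_cone_def fixed_set_def split: if_splits)
  then show ?thesis by blast
qed

end

section \<open>Differentiability of Lipschitz curves\<close>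

text \<open>The intervals straddle \<open>t\<close> strictly instead of ending at \<open>t\<close>,
  so one pair \<open>u\<close>, \<open>v\<close> serves a whole neighbourhood of \<open>t\<close>.
  \<open>slope_above\<close> follows the same convention.\<close>

definition slope_below :: "(real \<Rightarrow> real) \<Rightarrow> real \<Rightarrow> real set" where
  "slope_below G p = {t. \<forall>d>0. \<exists>u v. u < t \<and> t < v \<and> v - u < d \<and> G v - G u < p * (v - u)}"

definition slope_above :: "(real \<Rightarrow> real) \<Rightarrow> real \<Rightarrow> real set" where
  "slope_above G q = {t. \<forall>d>0. \<exists>u v. u < t \<and> t < v \<and> v - u < d \<and> G v - G u > q * (v - u)}"

text \<open>For each bound on the length the admissible points form a union of open intervals,
  whatever \<open>P\<close> is. Countably many bounds suffice, so the set is a G-delta.\<close>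

lemma borel_straddle:
  "{t::real. \<forall>d>0. \<exists>u v. u < t \<and> t < v \<and> v - u < d \<and> P u v} \<in> sets borel"
proof -
  have "{t. \<forall>d>0. \<exists>u v. u < t \<and> t < v \<and> v - u < d \<and> P u v}
      = (\<Inter>n. \<Union>{{u<..<v} | u v. v - u < inverse (real (Suc n)) \<and> P u v})" (is "?A = ?B")
  proof
    show "?A \<subseteq> ?B"
    proof clarify
      fix t n assume t: "\<forall>d>0. \<exists>u v. u < t \<and> t < v \<and> v - u < d \<and> P u v"
      have "0 < inverse (real (Suc n))" by simp
      with t obtain u v where "u < t" "t < v" "v - u < inverse (real (Suc n))" "P u v" by blast
      then show "t \<in> \<Union>{{u<..<v} | u v. v - u < inverse (real (Suc n)) \<and> P u v}"
        by (intro UnionI[of "{u<..<v}"]) auto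
    qed
    show "?B \<subseteq> ?A"
    proof clarify
      fix t d :: real assume t: "t \<in> ?B" and "d > 0"
      then obtain n where n: "inverse (real (Suc n)) < d" using reals_Archimedean by blast
      from t obtain u v where "v - u < inverse (real (Suc n))" "P u v" "t \<in> {u<..<v}" by blast
      with n show "\<exists>u v. u < t \<and> t < v \<and> v - u < d \<and> P u v"
        by (intro exI[of _ u] exI[of _ v]) auto
    qed
  qed
  also have "\<dots> \<in> sets borel"
    by (intro sets.countable_INT'' borel_open open_Union) auto
  finally show ?thesis .
qed

lemma Union_cball_measurable:
  assumes "countable C" shows "(\<Union>(c::real,r)\<in>C. cball c r) \<in> sets borel"
  using assms by (intro sets.countable_UN') (auto split: prod.splits)

lemma cball_interval_measure:
  assumes "mono G" "continuous_on UNIV G" "r > 0"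
  shows "emeasure (interval_measure G) (cball (c::real) r) = ennreal (G (c + r) - G (c - r))"
  unfolding cball_eq_atLeastAtMost using assms
  by (intro emeasure_interval_measure_Icc) (auto simp: mono_def)

lemma disjoint_family_cballs:
  assumes "pairwise (\<lambda>i j. disjnt (cball (fst i) (snd i)) (cball (fst j) (snd j))) C"
  shows "disjoint_family_on (\<lambda>(c::real,r). cball c r) C"
  using assms by (fastforce simp: pairwise_def disjoint_family_on_def disjnt_def simp del: mem_cball split: prod.splits)

text \<open>Vitali's theorem is applied to the intervals seen as balls about their midpoints;
  \<open>t\<close> has to lie in the ball but need not be its centre. Confining the balls to an open
  \<open>U\<close> is what allows coverings to be nested.\<close>

lemma Vitali_covering_straddle:
  fixes S :: "real set" and P :: "real \<Rightarrow> real \<Rightarrow> bool"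
  assumes "open U"
    and S: "\<And>t. t \<in> S \<Longrightarrow> t \<in> U \<and> (\<forall>d>0. \<exists>u v. u < t \<and> t < v \<and> v - u < d \<and> P u v)"
  obtains C where "countable C" "\<And>c r. (c, r) \<in> C \<Longrightarrow> r > 0 \<and> cball c r \<subseteq> U \<and> P (c - r) (c + r)"
    "disjoint_family_on (\<lambda>(c,r). cball c r) C" "negligible (S - (\<Union>(c,r)\<in>C. cball c r))"
proof -
  define K where "K = {(c, r). r > 0 \<and> cball c r \<subseteq> U \<and> P (c - r) (c + r)}"
  have cov: "\<exists>i. i \<in> K \<and> t \<in> cball (fst i) (snd i) \<and> snd i < d" if t: "t \<in> S" "d > 0" for t d
  proof -
    from S[OF t(1)] \<open>open U\<close> obtain e where e: "e > 0" "ball t e \<subseteq> U"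
      using open_contains_ball by blast
    from S[OF t(1)] e(1) \<open>d > 0\<close> obtain u v where uv: "u < t" "t < v" "v - u < min d e" "P u v"
      by (metis min_less_iff_conj)
    define c r where "c = (u + v) / 2" and "r = (v - u) / 2"
    then have cr: "c - r = u" "c + r = v" "r > 0" "r < d" using uv by (auto simp: field_simps)
    have cb: "cball c r = {u..v}" by (simp only: cball_eq_atLeastAtMost cr)
    have "{u..v} \<subseteq> ball t e" using uv by (auto simp: dist_real_def)
    with e uv cr cb have "(c, r) \<in> K" by (auto simp: K_def)
    moreover have "t \<in> cball c r" unfolding cb using uv by auto
    ultimately show ?thesis using cr by (intro exI[of _ "(c, r)"]) auto
  qed
  obtain C where C: "countable C" "C \<subseteq> K"
     "pairwise (\<lambda>i j. disjnt (cball (fst i) (snd i)) (cball (fst j) (snd j))) C"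
     "negligible(S - (\<Union>i \<in> C. cball (fst i) (snd i)))"
  proof (rule Vitali_covering_theorem_cballs[of K snd S fst])
    show "0 < snd i" if "i \<in> K" for i using that by (auto simp: K_def)
  qed (use cov in blast)+
  show thesis
  proof (rule that[OF C(1) _ disjoint_family_cballs[OF C(3)]])
    show "negligible (S - (\<Union>(c,r)\<in>C. cball c r))"
      using C(4) by (simp add: case_prod_unfold)
  qed (use C(2) K_def in auto)
qed

lemma emeasure_lborel_cball_real: "r > 0 \<Longrightarrow> emeasure lborel (cball (c::real) r) = ennreal (2 * r)"
  by (simp add: cball_eq_atLeastAtMost)

text \<open>Countable additivity over disjoint balls. It is applied twice, with Lebesgue measure and
  the measure induced by \<open>G\<close> exchanging places.\<close>

lemma emeasure_Union_cball_mono: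
  fixes M N :: "real measure"
  assumes "countable C" "disjoint_family_on (\<lambda>(c,r). cball c r) C"
    and "sets M = sets borel" "sets N = sets borel"
    and le: "\<And>c r. (c, r) \<in> C \<Longrightarrow> k * emeasure M (cball c r) \<le> l * emeasure N (cball c r)"
  shows "k * emeasure M (\<Union>(c,r)\<in>C. cball c r) \<le> l * emeasure N (\<Union>(c,r)\<in>C. cball c r)"
proof -
  have *: "k * emeasure M (\<Union>(c,r)\<in>C. cball c r) = (\<integral>\<^sup>+i. k * emeasure M (case i of (c,r) \<Rightarrow> cball c r) \<partial>count_space C)"
    if "sets M = sets borel" for M :: "real measure" and k
    using assms(1,2) that
    by (subst emeasure_UN_countable) (auto simp: nn_integral_cmult split: prod.splits)
  show ?thesis
    unfolding *[OF assms(3)] *[OF assms(4)] using le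
    by (intro nn_integral_mono) auto
qed

lemma emeasure_le_if_negligible_diff:
  assumes "A \<in> sets borel" "B \<in> sets borel" "negligible (A - B)"
  shows "emeasure lborel A \<le> emeasure lborel (B :: 'a::euclidean_space set)"
proof -
  have "A - B \<in> null_sets lborel"
    using assms negligible_iff_null_sets null_sets_completion_iff by (metis sets.Diff sets_lborel)
  then have "emeasure lborel (B \<union> (A - B)) = emeasure lborel B"
    using assms by (intro emeasure_Un_null_set) auto
  then show ?thesis
    using emeasure_mono[of A "B \<union> (A - B)" lborel] assms by auto
qed

text \<open>Two nested Vitali coverings: first by intervals of slope below \<open>p\<close>, then inside these by
  intervals of slope above \<open>q\<close>. The measure induced by \<open>G\<close> compares the two.\<close>

lemma negligible_slope_gap:
  assumes mono: "mono G" and cont: "continuous_on UNIV G" and pq: "0 \<le> p" "p < q"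
  shows "negligible (slope_below G p \<inter> slope_above G q)"
proof (subst negligible_on_intervals, intro allI)
  fix a b :: real
  \<comment> \<open>The box makes the measure \<open>m\<close> of \<open>S\<close> finite, so that
    \<open>q * m <= p * m\<close> can force \<open>m = 0\<close>.\<close>
  define S where "S = slope_below G p \<inter> slope_above G q \<inter> cbox a b"
  have S_borel: "S \<in> sets borel"
    unfolding S_def slope_below_def slope_above_def by (intro sets.Int borel_straddle) auto
  let ?m = "emeasure lborel" and ?V = "emeasure (interval_measure G)"
  have "?m S \<le> ?m (cbox a b)" by (intro emeasure_mono) (auto simp: S_def)
  also have "\<dots> < \<infinity>" using emeasure_lborel_cbox_finite[of a b] by (simp only: infinity_ennreal_def)
  finally obtain m where m: "?m S = ennreal m" "0 \<le> m"
    by (metis infinity_ennreal_def ennreal_cases less_irrefl)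
  have bound: "q * m \<le> p * (m + e)" if e: "e > 0" for e
  proof -
    obtain U where U: "open U" "S \<subseteq> U" "emeasure lebesgue (U - S) < ennreal e"
      by (rule sets_lebesgue_outer_open[of S e]) (use S_borel e in auto)
    obtain C1 where C1: "countable C1"
      and C1': "\<And>c r. (c, r) \<in> C1 \<Longrightarrow> r > 0 \<and> cball c r \<subseteq> U \<and> G (c + r) - G (c - r) < p * ((c + r) - (c - r))"
      and C1'': "disjoint_family_on (\<lambda>(c,r). cball c r) C1" "negligible (S - (\<Union>(c,r)\<in>C1. cball c r))"
    proof (rule Vitali_covering_straddle[OF U(1), of S "\<lambda>u v. G v - G u < p * (v - u)"])
      fix t assume "t \<in> S"
      then show "t \<in> U \<and> (\<forall>d>0. \<exists>u v. u < t \<and> t < v \<and> v - u < d \<and> G v - G u < p * (v - u))"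
        using U(2) unfolding S_def slope_below_def by blast
    qed (rule that)
    note C1 = C1 C1''
    \<comment> \<open>Open balls, because the second covering has to live inside an open
      set.\<close>
    define W where "W = (\<Union>(c,r)\<in>C1. ball c r)"
    define V1 where "V1 = (\<Union>(c,r)\<in>C1. cball c r)"
    have "open W" unfolding W_def by (auto split: prod.splits)
    obtain C2 where C2: "countable C2"
      and C2': "\<And>c r. (c, r) \<in> C2 \<Longrightarrow> r > 0 \<and> cball c r \<subseteq> W \<and> G (c + r) - G (c - r) > q * ((c + r) - (c - r))"
      and C2'': "disjoint_family_on (\<lambda>(c,r). cball c r) C2" "negligible (S \<inter> W - (\<Union>(c,r)\<in>C2. cball c r))"
    proof (rule Vitali_covering_straddle[OF \<open>open W\<close>, of "S \<inter> W" "\<lambda>u v. G v - G u > q * (v - u)"])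
      fix t assume "t \<in> S \<inter> W"
      then show "t \<in> W \<and> (\<forall>d>0. \<exists>u v. u < t \<and> t < v \<and> v - u < d \<and> G v - G u > q * (v - u))"
        unfolding S_def slope_above_def by blast
    qed (rule that)
    note C2 = C2 C2''
    define V2 where "V2 = (\<Union>(c,r)\<in>C2. cball c r)"
    have V[measurable]: "V1 \<in> sets borel" "V2 \<in> sets borel"
      unfolding V1_def V2_def using C1(1) C2(1) by (auto intro: Union_cball_measurable)
    \<comment> \<open>Passing from closed to open balls loses only countably many endpoints.\<close>
    have "negligible (S - W)"
    proof (rule negligible_subset)
      show "negligible ((S - V1) \<union> (\<Union>(c,r)\<in>C1. {c - r, c + r}))"
      proof (rule negligible_Un)
        have "countable (\<Union>(c,r)\<in>C1. {c - r, c + r})" using C1(1) by (auto split: prod.splits)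
        then show "negligible (\<Union>(c,r)\<in>C1. {c - r, c + r})"
          unfolding negligible_iff_null_sets by (intro null_sets_completionI countable_imp_null_set_lborel)
      qed (use C1(3) V1_def in auto)
      show "S - W \<subseteq> (S - V1) \<union> (\<Union>(c,r)\<in>C1. {c - r, c + r})"
        by (force simp: W_def V1_def dist_real_def abs_if)
    qed
    then have "negligible (S - V2)"
      by (rule negligible_subset[OF negligible_Un[OF _ C2(3)]]) (auto simp: V2_def)
    then have "?m S \<le> ?m V2"
      using S_borel V by (intro emeasure_le_if_negligible_diff)
    \<comment> \<open>With mu the measure induced by \<open>G\<close>, the chain is q m <= q |V2| <=
      mu(V2) <= mu(V1) <= p |V1| <= p |U| <= p (m + e).\<close>
    then have "ennreal q * ?m S \<le> ennreal q * ?m V2" by (rule mult_left_mono) simp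
    also have "\<dots> \<le> 1 * ?V V2"
      unfolding V2_def
    proof (rule emeasure_Union_cball_mono[OF C2(1,2)])
      fix c r assume "(c, r) \<in> C2"
      with C2' pq show "ennreal q * ?m (cball c r) \<le> 1 * ?V (cball c r)"
        by (auto simp: emeasure_lborel_cball_real cball_interval_measure[OF mono cont] less_imp_le
            simp flip: ennreal_mult intro!: ennreal_leI)
    qed auto
    also have "\<dots> \<le> 1 * ?V V1"
    proof (intro mult_left_mono emeasure_mono)
      have "V2 \<subseteq> W"
      proof
        fix x assume "x \<in> V2"
        then obtain c r where "(c, r) \<in> C2" "x \<in> cball c r" unfolding V2_def by blast
        with C2' show "x \<in> W" by blast
      qed
      also have "W \<subseteq> V1" unfolding W_def V1_def by (intro UN_mono) auto
      finally show "V2 \<subseteq> V1" .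
    qed auto
    also have "\<dots> \<le> ennreal p * ?m V1"
      unfolding V1_def
    proof (rule emeasure_Union_cball_mono[OF C1(1,2)])
      fix c r assume "(c, r) \<in> C1"
      with C1' pq show "1 * ?V (cball c r) \<le> ennreal p * ?m (cball c r)"
        by (auto simp: emeasure_lborel_cball_real cball_interval_measure[OF mono cont] less_imp_le
            simp flip: ennreal_mult intro!: ennreal_leI)
    qed auto
    also have "\<dots> \<le> ennreal p * ?m U"
      using C1' U by (intro mult_left_mono emeasure_mono) (auto simp: V1_def)
    also have "?m U \<le> ?m S + ?m (U - S)"
      using U S_borel emeasure_subadditive[of S lborel "U - S"] by (auto simp: Un_absorb1)
    also have "\<dots> \<le> ennreal m + ennreal e"
      using U S_borel m by (intro add_mono) (auto simp: less_imp_le)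
    finally have "ennreal q * ennreal m \<le> ennreal p * (ennreal m + ennreal e)"
      unfolding m(1) by (simp add: mult_left_mono)
    then show ?thesis
      using m(2) e pq by (simp flip: ennreal_mult ennreal_plus)
  qed
  have "((\<lambda>e. p * (m + e)) \<longlongrightarrow> p * (m + 0)) (at_right 0)" by (intro tendsto_intros)
  then have "q * m \<le> p * (m + 0)"
    by (rule tendsto_lowerbound) (auto simp: eventually_at_right_less intro!: eventually_mono[OF eventually_at_right_less[of 0]] bound)
  then have "m = 0" using m(2) pq
    by (smt (verit) mult_less_cancel_right)
  then have "S \<in> null_sets lborel" using m S_borel by auto
  then show "negligible (slope_below G p \<inter> slope_above G q \<inter> cbox a b)"
    unfolding negligible_iff_null_sets S_def by (rule null_sets_completionI)
qed

text \<open>Let one endpoint of a straddling interval tend to \<open>t\<close>: by continuity the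
  estimate passes to the one-sided difference quotients that define the derivative.\<close>

lemma straddle_closure:
  fixes G :: "real \<Rightarrow> real"
  assumes cont: "continuous_on UNIV G"
    and str: "\<And>u v. u < t \<Longrightarrow> t < v \<Longrightarrow> v - u < d \<Longrightarrow> \<bar>G v - G u - c * (v - u)\<bar> \<le> e * (v - u)"
    and s: "\<bar>s - t\<bar> < d"
  shows "\<bar>G s - G t - c * (s - t)\<bar> \<le> e * \<bar>s - t\<bar>"
proof -
  have [tendsto_intros]: "(G \<longlongrightarrow> G t) (at t within X)" for X
    using cont by (simp add: continuous_on_eq_continuous_at isCont_def tendsto_within_subset[OF _ subset_UNIV])
  consider "s = t" | "s > t" | "s < t" by linarith
  then show ?thesis
  proof cases
    case 2
    have "((\<lambda>u. e * (s - u) - \<bar>G s - G u - c * (s - u)\<bar>) \<longlongrightarrow> e * (s - t) - \<bar>G s - G t - c * (s - t)\<bar>) (at_left t)"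
      by (intro tendsto_intros)
    moreover have "\<forall>\<^sub>F u in at_left t. u \<in> {s - d<..<t}"
      using 2 s by (intro eventually_at_left_real) auto
    then have "\<forall>\<^sub>F u in at_left t. 0 \<le> e * (s - u) - \<bar>G s - G u - c * (s - u)\<bar>"
      by eventually_elim (use 2 str[of _ s] in auto)
    ultimately have "0 \<le> e * (s - t) - \<bar>G s - G t - c * (s - t)\<bar>"
      by (rule tendsto_lowerbound) simp
    with 2 show ?thesis by simp
  next
    case 3
    have "((\<lambda>u. e * (u - s) - \<bar>G u - G s - c * (u - s)\<bar>) \<longlongrightarrow> e * (t - s) - \<bar>G t - G s - c * (t - s)\<bar>) (at_right t)"
      by (intro tendsto_intros)
    moreover have "\<forall>\<^sub>F u in at_right t. u \<in> {t<..<s + d}"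
      using 3 s by (intro eventually_at_right_real) auto
    then have "\<forall>\<^sub>F u in at_right t. 0 \<le> e * (u - s) - \<bar>G u - G s - c * (u - s)\<bar>"
      by eventually_elim (use 3 str[of s] in auto)
    ultimately have "0 \<le> e * (t - s) - \<bar>G t - G s - c * (t - s)\<bar>"
      by (rule tendsto_lowerbound) simp
    then show ?thesis using 3 by (simp add: abs_if algebra_simps split: if_splits)
  qed simp
qed

text \<open>The derivative is the upper straddling slope \<open>c\<close>. Slopes just below
  \<open>c\<close> are exceeded on arbitrarily short intervals, so the absence of a gap rules out
  slopes falling below any smaller rational, and all short quotients lie within \<open>e\<close> of
  \<open>c\<close>.\<close>

lemma differentiable_off_slope_gaps:
  assumes mono: "mono G" and lip: "\<And>u v. u \<le> v \<Longrightarrow> G v - G u \<le> L * (v - u)"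
    and cont: "continuous_on UNIV G"
    and gap: "\<And>p q. p \<in> \<rat> \<Longrightarrow> q \<in> \<rat> \<Longrightarrow> p < q \<Longrightarrow> t \<notin> slope_below G p \<inter> slope_above G q"
  shows "G differentiable (at t)"
proof -
  define c where "c = Inf {q. t \<notin> slope_above G q}"
  have "t \<notin> slope_above G L"
    unfolding slope_above_def using lip by (auto simp: not_less intro!: exI[of _ 1])
  then have ne: "{q. t \<notin> slope_above G q} \<noteq> {}" by blast
  have neg: "t \<in> slope_above G q" if "q < 0" for q
    unfolding slope_above_def
  proof clarify
    fix d :: real assume "d > 0"
    have "q * (2 * (d / 3)) < 0" using that \<open>d > 0\<close> by (simp add: mult_neg_pos)
    moreover have "G (t - d / 3) \<le> G (t + d / 3)" using mono \<open>d > 0\<close> by (auto simp: mono_def)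
    ultimately show "\<exists>u v. u < t \<and> t < v \<and> v - u < d \<and> q * (v - u) < G v - G u"
      using \<open>d > 0\<close> by (intro exI[of _ "t - d / 3"] exI[of _ "t + d / 3"]) (auto simp: algebra_simps)
  qed
  then have bdd: "bdd_below {q. t \<notin> slope_above G q}"
    by (intro bdd_belowI[of _ 0]) (auto simp: not_less[symmetric])
  have "\<exists>d>0. \<forall>s. norm (s - t) < d \<longrightarrow> norm (G s - G t - c * (s - t)) \<le> e * norm (s - t)" if "e > 0" for e
  proof -
    obtain q where q: "q < c + e" "t \<notin> slope_above G q"
      using cInf_lessD[OF ne, of "c + e"] \<open>e > 0\<close> by (auto simp: c_def)
    then obtain d1 where d1: "d1 > 0" "\<And>u v. u < t \<Longrightarrow> t < v \<Longrightarrow> v - u < d1 \<Longrightarrow> G v - G u \<le> q * (v - u)"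
      unfolding slope_above_def mem_Collect_eq by (meson not_less)
    \<comment> \<open>Two rationals below \<open>c\<close> are chosen because \<open>gap\<close>
      speaks of a strict rational pair: \<open>q'\<close> is exceeded near \<open>t\<close>, and
      hence \<open>p\<close> is a lower bound for short slopes.\<close>
    obtain q' where q': "q' \<in> \<rat>" "c - e < q'" "q' < c"
      using Rats_dense_in_real[of "c - e" c] \<open>e > 0\<close> by auto
    obtain p where p: "p \<in> \<rat>" "c - e < p" "p < q'"
      using Rats_dense_in_real[OF q'(2)] by auto
    have "t \<in> slope_above G q'"
      using cInf_lower[OF _ bdd, of q'] q' by (fastforce simp: c_def)
    with gap p q' have "t \<notin> slope_below G p" by blast
    then obtain d2 where d2: "d2 > 0" "\<And>u v. u < t \<Longrightarrow> t < v \<Longrightarrow> v - u < d2 \<Longrightarrow> p * (v - u) \<le> G v - G u"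
      unfolding slope_below_def mem_Collect_eq by (meson not_less)
    have "\<bar>G v - G u - c * (v - u)\<bar> \<le> e * (v - u)" if uv: "u < t" "t < v" "v - u < min d1 d2" for u v
    proof -
      have "q * (v - u) \<le> (c + e) * (v - u)" "(c - e) * (v - u) \<le> p * (v - u)"
        using uv q p by (auto intro!: mult_right_mono)
      with d1(2)[of u v] d2(2)[of u v] uv show ?thesis
        by (auto simp: abs_le_iff algebra_simps)
    qed
    then have "\<bar>G s - G t - c * (s - t)\<bar> \<le> e * \<bar>s - t\<bar>" if "\<bar>s - t\<bar> < min d1 d2" for s
      using straddle_closure[OF cont _ that] by blast
    with d1(1) d2(1) show ?thesis
      by (intro exI[of _ "min d1 d2"]) auto
  qed
  then have "(G has_derivative (\<lambda>h. c * h)) (at t)"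
    unfolding has_derivative_within_alt by (auto intro: bounded_linear_mult_right)
  then show ?thesis by (auto simp: differentiable_def)
qed

text \<open>A point of non-differentiability exhibits a gap between two rational slopes, and there
  are only countably many such pairs.\<close>

lemma negligible_not_differentiable_lipschitz_real:
  fixes g :: "real \<Rightarrow> real"
  assumes lip: "L-lipschitz_on UNIV g"
  shows "negligible {t. \<not> g differentiable (at t)}"
proof -
  \<comment> \<open>Adding the slope \<open>L\<close> makes the function nondecreasing, so that it
    induces a measure.\<close>
  define G where "G t = g t + L * t" for t
  have lip': "\<bar>g v - g u\<bar> \<le> L * \<bar>v - u\<bar>" for u v
    using lipschitz_onD[OF lip, of v u] by (simp add: dist_real_def)
  have mono: "mono G"
  proof (rule monoI)
    fix u v :: real assume "u \<le> v"
    with lip'[of v u] show "G u \<le> G v" by (simp add: G_def algebra_simps)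
  qed
  have up: "G v - G u \<le> (2 * L) * (v - u)" if "u \<le> v" for u v
    using lip'[of v u] that by (simp add: G_def algebra_simps)
  have cont: "continuous_on UNIV G"
    unfolding G_def using lipschitz_on_continuous_on[OF lip] by (intro continuous_intros)
  define I :: "(real \<times> real) set" where "I = {(p, q) \<in> \<rat> \<times> \<rat>. 0 \<le> p \<and> p < q}"
  define N where "N = (\<Union>(p,q)\<in>I. slope_below G p \<inter> slope_above G q)"
  have "countable (\<rat> \<times> \<rat> :: (real \<times> real) set)" by (intro countable_SIGMA countable_rat)
  then have "countable I" by (rule countable_subset[rotated]) (auto simp: I_def)
  have "negligible N"
    unfolding N_def
  proof (intro negligible_countable_Union countable_image \<open>countable I\<close>)
    fix X assume "X \<in> (\<lambda>(p,q). slope_below G p \<inter> slope_above G q) ` I"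
    then show "negligible X" using negligible_slope_gap[OF mono cont] by (auto simp: I_def)
  qed
  moreover have "g differentiable (at t)" if t: "t \<notin> N" for t
  proof -
    have "G differentiable (at t)"
    proof (rule differentiable_off_slope_gaps[OF mono up cont])
      fix p q :: real assume pq: "p \<in> \<rat>" "q \<in> \<rat>" "p < q"
      show "t \<notin> slope_below G p \<inter> slope_above G q"
      proof (cases "p \<ge> 0")
        case True then show ?thesis using t pq by (fastforce simp: N_def I_def)
      next
        case False
        \<comment> \<open>A nondecreasing function has no interval of negative slope.\<close>
        have "t \<notin> slope_below G p"
        proof
          assume "t \<in> slope_below G p"
          then obtain u v where "u < t" "t < v" "G v - G u < p * (v - u)"
            unfolding slope_below_def using zero_less_one by blast
          moreover have "G u \<le> G v" using mono calculation by (auto simp: mono_def)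
          moreover have "p * (v - u) \<le> 0" using False calculation by (intro mult_nonpos_nonneg) auto
          ultimately show False by linarith
        qed
        then show ?thesis by blast
      qed
    qed auto
    then have "(\<lambda>t. G t - L * t) differentiable (at t)" by (intro derivative_intros) auto
    then show ?thesis by (simp add: G_def)
  qed
  ultimately show ?thesis by (elim negligible_subset) blast
qed

lemma negligible_not_differentiable_lipschitz:
  fixes g :: "real \<Rightarrow> 'a::euclidean_space"
  assumes lip: "L-lipschitz_on UNIV g"
  shows "negligible {t. \<not> g differentiable (at t)}"
proof -
  have "{t. \<not> g differentiable (at t)} = (\<Union>i\<in>Basis. {t. \<not> (\<lambda>x. g x \<bullet> i) differentiable (at t)})"
    by (subst differentiable_componentwise_within) auto
  moreover have "negligible {t. \<not> (\<lambda>x. g x \<bullet> i) differentiable (at t)}" if i: "i \<in> Basis" for i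
  proof (rule negligible_not_differentiable_lipschitz_real[of L], rule lipschitz_onI)
    fix x y :: real
    have "dist (g x \<bullet> i) (g y \<bullet> i) \<le> dist (g x) (g y)"
      using Basis_le_norm[OF i, of "g x - g y"] by (simp add: dist_norm inner_diff_left)
    then show "dist (g x \<bullet> i) (g y \<bullet> i) \<le> L * dist x y"
      using lipschitz_onD[OF lip, of x y] by simp
  qed (use lip lipschitz_on_nonneg in auto)
  ultimately show ?thesis by (auto intro: negligible_Union)
qed

section \<open>Absolutely continuous functions\<close>

lemma absolutely_continuous_on_intervalE:
  assumes "absolutely_continuous_on_interval a b x" "e > 0"
  obtains d where "d > 0"
    "\<And>(n::nat) u v. (\<And>i. i < n \<Longrightarrow> a \<le> u i \<and> u i \<le> v i \<and> v i \<le> b) \<Longrightarrow>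
        disjoint_family_on (\<lambda>i. {u i<..<v i}) {..<n} \<Longrightarrow> (\<Sum>i<n. v i - u i) < d \<Longrightarrow>
        (\<Sum>i<n. norm (x (v i) - x (u i))) < e"
  using assms unfolding absolutely_continuous_on_interval_def by meson

text \<open>Applied to Lipschitz functions, with \<open>A = 0\<close>, and to the weighted squared
  distance of two solutions, where \<open>B\<close> comes from the exponential weight.\<close>

lemma absolutely_continuous_on_interval_dominated:
  assumes x: "absolutely_continuous_on_interval a b x" and y: "absolutely_continuous_on_interval a b y"
    and nonneg: "A \<ge> 0" "B \<ge> 0"
    and dom: "\<And>u v. a \<le> u \<Longrightarrow> u \<le> v \<Longrightarrow> v \<le> b \<Longrightarrow>
      norm (g v - g u) \<le> A * (norm (x v - x u) + norm (y v - y u)) + B * (v - u)"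
  shows "absolutely_continuous_on_interval a b g"
  unfolding absolutely_continuous_on_interval_def
proof (intro allI impI)
  fix e :: real assume "e > 0"
  \<comment> \<open>The summand 1 keeps the denominator positive and the final inequality
    strict.\<close>
  define e' where "e' = e / (2 * A + B + 1)"
  have e': "e' > 0" and e_eq: "A * (e' + e') + B * e' < e"
    using \<open>e > 0\<close> nonneg by (auto simp: e'_def field_simps add_pos_nonneg)
  obtain d1 where d1: "d1 > 0"
    "\<And>(n::nat) u v. (\<And>i. i < n \<Longrightarrow> a \<le> u i \<and> u i \<le> v i \<and> v i \<le> b) \<Longrightarrow>
        disjoint_family_on (\<lambda>i. {u i<..<v i}) {..<n} \<Longrightarrow> (\<Sum>i<n. v i - u i) < d1 \<Longrightarrow>
        (\<Sum>i<n. norm (x (v i) - x (u i))) < e'"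
    using absolutely_continuous_on_intervalE[OF x e'] by blast
  obtain d2 where d2: "d2 > 0"
    "\<And>(n::nat) u v. (\<And>i. i < n \<Longrightarrow> a \<le> u i \<and> u i \<le> v i \<and> v i \<le> b) \<Longrightarrow>
        disjoint_family_on (\<lambda>i. {u i<..<v i}) {..<n} \<Longrightarrow> (\<Sum>i<n. v i - u i) < d2 \<Longrightarrow>
        (\<Sum>i<n. norm (y (v i) - y (u i))) < e'"
    using absolutely_continuous_on_intervalE[OF y e'] by blast
  show "\<exists>\<delta>>0. \<forall>(n::nat) u v.
      (\<forall>i<n. a \<le> u i \<and> u i \<le> v i \<and> v i \<le> b) \<and> disjoint_family_on (\<lambda>i. {u i<..<v i}) {..<n} \<and>
      (\<Sum>i<n. v i - u i) < \<delta> \<longrightarrow> (\<Sum>i<n. norm (g (v i) - g (u i))) < e"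
  proof (intro exI conjI allI impI)
    show "min e' (min d1 d2) > 0" using e' d1(1) d2(1) by simp
    fix n :: nat and u v
    assume *: "(\<forall>i<n. a \<le> u i \<and> u i \<le> v i \<and> v i \<le> b) \<and>
      disjoint_family_on (\<lambda>i. {u i<..<v i}) {..<n} \<and> (\<Sum>i<n. v i - u i) < min e' (min d1 d2)"
    have "(\<Sum>i<n. norm (g (v i) - g (u i)))
        \<le> (\<Sum>i<n. A * (norm (x (v i) - x (u i)) + norm (y (v i) - y (u i))) + B * (v i - u i))"
      using * by (intro sum_mono dom) auto
    also have "\<dots> = A * ((\<Sum>i<n. norm (x (v i) - x (u i))) + (\<Sum>i<n. norm (y (v i) - y (u i))))
        + B * (\<Sum>i<n. v i - u i)"
      by (simp add: sum.distrib distrib_left flip: sum_distrib_left)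
    also have "\<dots> \<le> A * (e' + e') + B * e'"
      using * nonneg d1(2)[of n u v] d2(2)[of n u v]
      by (intro add_mono mult_left_mono) (auto simp: less_imp_le)
    also note e_eq
    finally show "(\<Sum>i<n. norm (g (v i) - g (u i))) < e" .
  qed
qed

lemma absolutely_continuous_on_interval_const: "absolutely_continuous_on_interval a b (\<lambda>_. c)"
  unfolding absolutely_continuous_on_interval_def by (auto intro: exI[of _ 1])

lemma absolutely_continuous_on_interval_lipschitz:
  assumes "K-lipschitz_on {a..b} x"
  shows "absolutely_continuous_on_interval a b x"
proof (rule absolutely_continuous_on_interval_dominated[of a b "\<lambda>_. 0::real" "\<lambda>_. 0::real" 0 K])
  fix u v assume "a \<le> u" "u \<le> v" "v \<le> b"
  then show "norm (x v - x u) \<le> 0 * (norm (0 - 0 :: real) + norm (0 - 0 :: real)) + K * (v - u)"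
    using lipschitz_onD[OF assms, of v u] by (simp add: dist_norm)
qed (use assms lipschitz_on_nonneg in \<open>auto intro: absolutely_continuous_on_interval_const\<close>)

lemma absolutely_continuous_on_interval_imp_continuous_on:
  assumes "absolutely_continuous_on_interval a b x"
  shows "continuous_on {a..b} x"
  unfolding continuous_on_iff
proof (intro ballI allI impI)
  fix t and e :: real assume t: "t \<in> {a..b}" and "e > 0"
  obtain d where d: "d > 0"
    "\<And>(n::nat) u v. (\<And>i. i < n \<Longrightarrow> a \<le> u i \<and> u i \<le> v i \<and> v i \<le> b) \<Longrightarrow>
        disjoint_family_on (\<lambda>i. {u i<..<v i}) {..<n} \<Longrightarrow> (\<Sum>i<n. v i - u i) < d \<Longrightarrow>
        (\<Sum>i<n. norm (x (v i) - x (u i))) < e"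
    using absolutely_continuous_on_intervalE[OF assms \<open>e > 0\<close>] by blast
  show "\<exists>d>0. \<forall>x'\<in>{a..b}. dist x' t < d \<longrightarrow> dist (x x') (x t) < e"
  proof (intro exI[of _ d] conjI ballI impI)
    fix s assume "s \<in> {a..b}" "dist s t < d"
    with t d(2)[of 1 "\<lambda>_. min s t" "\<lambda>_. max s t"] show "dist (x s) (x t) < e"
      by (cases "s \<le> t") (auto simp: dist_norm norm_minus_commute disjoint_family_on_def)
  qed (rule d)
qed

text \<open>Carries absolute continuity over from intervals numbered by naturals to intervals
  indexed by any finite set, such as the cells of a tagged division.\<close>

lemma absolutely_continuous_sum_finite:
  assumes "finite p" and ac: "\<And>(n::nat) u v. (\<And>i. i < n \<Longrightarrow> a \<le> u i \<and> u i \<le> v i \<and> v i \<le> b) \<Longrightarrow>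
        disjoint_family_on (\<lambda>i. {u i<..<v i}) {..<n} \<Longrightarrow> (\<Sum>i<n. v i - u i) < d \<Longrightarrow>
        (\<Sum>i<n. norm (x (v i) - x (u i))) < (e::real)"
    and p: "\<And>i. i \<in> p \<Longrightarrow> a \<le> U i \<and> U i \<le> V i \<and> V i \<le> b"
      "disjoint_family_on (\<lambda>i. {U i<..<V i}) p" "(\<Sum>i\<in>p. V i - U i) < d"
  shows "(\<Sum>i\<in>p. norm (x (V i) - x (U i))) < e"
proof -
  obtain f :: "nat \<Rightarrow> _" where f: "bij_betw f {..<card p} p"
    using ex_bij_betw_nat_finite[OF \<open>finite p\<close>] by (auto simp: atLeast0LessThan)
  have "disjoint_family_on (\<lambda>i. {U (f i)<..<V (f i)}) {..<card p}"
    using p(2) f unfolding disjoint_family_on_def bij_betw_def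
    by (metis imageI inj_onD)
  then have "(\<Sum>i<card p. norm (x (V (f i)) - x (U (f i)))) < e"
    using p(1,3) f sum.reindex_bij_betw[OF f, of "\<lambda>i. V i - U i"]
    by (intro ac) (auto dest: bij_betwE)
  then show ?thesis using sum.reindex_bij_betw[OF f, of "\<lambda>i. norm (x (V i) - x (U i))"] by simp
qed

text \<open>A Cousin-type argument: the exceptional null set is absorbed by an open set of small measure,
  on which absolute continuity bounds the increments.\<close>

lemma absolutely_continuous_nonincreasing:
  fixes g :: "real \<Rightarrow> real"
  assumes ac: "absolutely_continuous_on_interval a b g" and "a \<le> b"
    and N: "negligible N"
    and deriv: "\<And>t. t \<in> {a..b} - N \<Longrightarrow> \<exists>D\<le>0. (g has_real_derivative D) (at t within {a..b})"
  shows "g b \<le> g a"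
proof (rule field_le_epsilon)
  fix e :: real assume "e > 0"
  \<comment> \<open>Half of \<open>e\<close> is spread over the interval at rate \<open>e1\<close>,
    the other half is left for cells tagged in \<open>N\<close>; the summand 1 covers
    \<open>a = b\<close>.\<close>
  define e1 where "e1 = e / (2 * (b - a + 1))"
  have "e1 > 0" "e1 * (b - a) \<le> e / 2" using \<open>e > 0\<close> \<open>a \<le> b\<close> by (auto simp: e1_def field_simps)
  obtain d where d: "d > 0"
    "\<And>(n::nat) u v. (\<And>i. i < n \<Longrightarrow> a \<le> u i \<and> u i \<le> v i \<and> v i \<le> b) \<Longrightarrow>
        disjoint_family_on (\<lambda>i. {u i<..<v i}) {..<n} \<Longrightarrow> (\<Sum>i<n. v i - u i) < d \<Longrightarrow>
        (\<Sum>i<n. norm (g (v i) - g (u i))) < e / 2"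
    using absolutely_continuous_on_intervalE[OF ac half_gt_zero[OF \<open>e > 0\<close>]] by blast
  obtain W where W: "open W" "N \<subseteq> W" "W \<in> lmeasurable" "measure lebesgue W < d"
  proof -
    have N': "N \<in> null_sets lebesgue" using N by (simp add: negligible_iff_null_sets)
    then obtain W where W: "open W" "N \<subseteq> W" "W - N \<in> lmeasurable" "emeasure lebesgue (W - N) < ennreal d"
      using sets_lebesgue_outer_open[of N d] \<open>d > 0\<close> by (metis null_setsD2)
    have "W = (W - N) \<union> N" using W(2) by blast
    then have em: "emeasure lebesgue W = emeasure lebesgue (W - N)"
      using emeasure_Un_null_set[OF fmeasurableD[OF W(3)] N'] by metis
    have "W = (W - N) \<union> (N \<inter> W)" by blast
    then have "W \<in> lmeasurable"
      using fmeasurable.Un[OF W(3), of "N \<inter> W"] N negligible_subset[of N "N \<inter> W"]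
      using negligible_imp_measurable by (metis inf_le1)
    moreover from this em W(4) have "measure lebesgue W < d"
      by (metis emeasure_eq_measure2 ennreal_less_iff measure_nonneg)
    ultimately show thesis using that W by blast
  qed
  \<comment> \<open>The factor \<open>s - t\<close> states the slope bounds on both sides of
    \<open>t\<close> in one inequality. At tags in \<open>N\<close> the gauge only keeps the cell
    inside \<open>W\<close>.\<close>
  have "\<exists>G. open G \<and> t \<in> G \<and> (if t \<in> N then G \<subseteq> W else t \<in> {a..b} \<longrightarrow>
      (\<forall>s\<in>G \<inter> {a..b}. (s - t) * (g s - g t) \<le> e1 * (s - t)\<^sup>2))" for t
  proof (cases "t \<in> N \<or> t \<notin> {a..b}")
    case True then show ?thesis using W by (cases "t \<in> N") (auto intro: exI[of _ W] exI[of _ UNIV])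
  next
    case False
    then obtain D where D: "D \<le> 0" "(g has_real_derivative D) (at t within {a..b})" using deriv by blast
    then obtain r where r: "r > 0" "\<And>s. s \<in> {a..b} \<Longrightarrow> norm (s - t) < r \<Longrightarrow> norm (g s - g t - D * (s - t)) \<le> e1 * norm (s - t)"
      using \<open>e1 > 0\<close> unfolding has_field_derivative_def has_derivative_within_alt by blast
    have "(s - t) * (g s - g t) \<le> e1 * (s - t)\<^sup>2" if "s \<in> {a..b}" "norm (s - t) < r" for s
    proof -
      have "(s - t) * (g s - g t) = D * (s - t)\<^sup>2 + (s - t) * (g s - g t - D * (s - t))"
        by (simp add: algebra_simps power2_eq_square)
      also have "(s - t) * (g s - g t - D * (s - t)) \<le> \<bar>s - t\<bar> * \<bar>g s - g t - D * (s - t)\<bar>"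
        by (metis abs_ge_self abs_mult)
      also have "\<dots> \<le> \<bar>s - t\<bar> * (e1 * \<bar>s - t\<bar>)" using r(2)[OF that] by (intro mult_left_mono) auto
      also have "\<dots> = e1 * (s - t)\<^sup>2" by (simp add: power2_eq_square abs_mult_self_eq)
      also have "D * (s - t)\<^sup>2 \<le> 0" using D(1) by (simp add: mult_nonpos_nonneg)
      finally show ?thesis by simp
    qed
    then show ?thesis using False r(1) by (intro exI[of _ "ball t r"]) (auto simp: dist_real_def abs_minus_commute)
  qed
  then obtain \<gamma> where \<gamma>: "\<And>t. open (\<gamma> t) \<and> t \<in> \<gamma> t"
    "\<And>t. t \<in> N \<Longrightarrow> \<gamma> t \<subseteq> W"
    "\<And>s t. t \<in> {a..b} - N \<Longrightarrow> s \<in> \<gamma> t \<inter> {a..b} \<Longrightarrow> (s - t) * (g s - g t) \<le> e1 * (s - t)\<^sup>2"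
    by (metis Diff_iff)
  then have "gauge \<gamma>" by (simp add: gauge_def)
  then obtain p where p: "p tagged_division_of {a..b}" "\<gamma> fine p"
    using fine_division_exists_real by blast
  have fin: "finite p" using p(1) by (rule tagged_division_of_finite)
  have cell: "Inf (snd i) \<le> fst i \<and> fst i \<le> Sup (snd i) \<and> a \<le> Inf (snd i) \<and> Sup (snd i) \<le> b
      \<and> snd i = {Inf (snd i)..Sup (snd i)} \<and> snd i \<subseteq> \<gamma> (fst i)" if "i \<in> p" for i
  proof -
    obtain t k where i: "i = (t, k)" by fastforce
    have tk: "t \<in> k" "k \<subseteq> {a..b}" "\<exists>u v. k = cbox u v" "k \<subseteq> \<gamma> t"
      using tagged_division_ofD(2-4)[OF p(1), of t k] that p(2) i by (auto simp: fine_def)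
    then obtain u v where "k = {u..v}" "u \<le> v" by fastforce
    with tk i show ?thesis by auto
  qed
  have disj: "disjoint_family_on (\<lambda>i. {Inf (snd i)<..<Sup (snd i)}) p"
    unfolding disjoint_family_on_def
  proof (intro ballI impI)
    fix i j assume ij: "i \<in> p" "j \<in> p" "i \<noteq> j"
    then have "interior (snd i) \<inter> interior (snd j) = {}"
      using tagged_division_ofD(5)[OF p(1)] by (metis prod.collapse)
    moreover have "interior (snd i) = {Inf (snd i)<..<Sup (snd i)}" "interior (snd j) = {Inf (snd j)<..<Sup (snd j)}"
      using cell[OF ij(1)] cell[OF ij(2)] by (metis interior_atLeastAtMost_real)+
    ultimately show "{Inf (snd i)<..<Sup (snd i)} \<inter> {Inf (snd j)<..<Sup (snd j)} = {}" by simp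
  qed
  define q where "q = {i \<in> p. fst i \<in> N}"
  have q: "q \<subseteq> p" "finite q" using fin by (auto simp: q_def)
  \<comment> \<open>Cells tagged in \<open>N\<close> have disjoint interiors inside
    \<open>W\<close>, so their total length is below \<open>d\<close>.\<close>
  have "(\<Sum>i\<in>q. Sup (snd i) - Inf (snd i)) = (\<Sum>i\<in>q. measure lebesgue {Inf (snd i)<..<Sup (snd i)})"
    using cell q by (intro sum.cong) (force simp: measure_def)+
  also have "\<dots> = measure lebesgue (\<Union>i\<in>q. {Inf (snd i)<..<Sup (snd i)})"
  proof (intro measure_finite_Union[symmetric] q(2))
    show "disjoint_family_on (\<lambda>i. {Inf (snd i)<..<Sup (snd i)}) q"
      using disjoint_family_on_mono[OF q(1) disj] .
    have "emeasure lborel {Inf (snd i)<..<Sup (snd i)} = ennreal (Sup (snd i) - Inf (snd i))" if "i \<in> q" for i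
      using cell[of i] q that by (intro emeasure_lborel_Ioo) force
    then show "emeasure lebesgue {Inf (snd i)<..<Sup (snd i)} \<noteq> \<infinity>" if "i \<in> q" for i
      using that by simp
  qed auto
  also have "\<dots> \<le> measure lebesgue W"
  proof (rule measure_mono_fmeasurable)
    have "{Inf (snd i)<..<Sup (snd i)} \<subseteq> W" if "i \<in> q" for i
    proof -
      have "{Inf (snd i)<..<Sup (snd i)} \<subseteq> snd i"
        using cell[of i] that q by (metis greaterThanLessThan_subseteq_atLeastAtMost_iff order_refl subsetD)
      also have "\<dots> \<subseteq> W" using cell[of i] that \<gamma>(2) by (auto simp: q_def)
      finally show ?thesis .
    qed
    then show "(\<Union>i\<in>q. {Inf (snd i)<..<Sup (snd i)}) \<subseteq> W" by blast
    show "(\<Union>i\<in>q. {Inf (snd i)<..<Sup (snd i)}) \<in> sets lebesgue" using q by auto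
  qed (use W in auto)
  also note W(4)
  finally have small: "(\<Sum>i\<in>q. Sup (snd i) - Inf (snd i)) < d" .
  have "(\<Sum>i\<in>q. norm (g (Sup (snd i)) - g (Inf (snd i)))) < e / 2"
  proof (rule absolutely_continuous_sum_finite[where a = a and b = b and d = d and x = g, OF q(2)])
    fix n :: nat and u v
    assume "\<And>i. i < n \<Longrightarrow> a \<le> u i \<and> u i \<le> v i \<and> v i \<le> b"
      "disjoint_family_on (\<lambda>i. {u i<..<v i}) {..<n}" "(\<Sum>i<n. v i - u i) < d"
    then show "(\<Sum>i<n. norm (g (v i) - g (u i))) < e / 2" by (rule d(2))
  next
    show "disjoint_family_on (\<lambda>i. {Inf (snd i)<..<Sup (snd i)}) q"
      using disjoint_family_on_mono[OF q(1) disj] .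
    show "a \<le> Inf (snd i) \<and> Inf (snd i) \<le> Sup (snd i) \<and> Sup (snd i) \<le> b" if "i \<in> q" for i
      using cell[of i] q(1) that by (meson order_trans subsetD)
  qed (rule small)
  moreover have "(\<Sum>i\<in>q. g (Sup (snd i)) - g (Inf (snd i))) \<le> (\<Sum>i\<in>q. norm (g (Sup (snd i)) - g (Inf (snd i))))"
    by (intro sum_mono) auto
  \<comment> \<open>At a good tag the cell is split at its tag, and the bound is applied to each
    half.\<close>
  moreover have "(\<Sum>i\<in>p - q. g (Sup (snd i)) - g (Inf (snd i))) \<le> (\<Sum>i\<in>p - q. e1 * (Sup (snd i) - Inf (snd i)))"
  proof (rule sum_mono)
    fix i assume i: "i \<in> p - q"
    define t u v where "t = fst i" and "u = Inf (snd i)" and "v = Sup (snd i)"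
    have tuv: "u \<le> t" "t \<le> v" "a \<le> u" "v \<le> b" "{u..v} \<subseteq> \<gamma> t"
      using cell[of i] i by (auto simp: t_def u_def v_def)
    have t: "t \<in> {a..b} - N" using i tuv by (auto simp: q_def t_def)
    have "v \<in> \<gamma> t \<inter> {a..b}" "u \<in> \<gamma> t \<inter> {a..b}" using tuv by auto
    from this[THEN \<gamma>(3)[OF t]] have uv: "(v - t) * (g v - g t) \<le> (v - t) * (e1 * (v - t))"
      "(t - u) * (g t - g u) \<le> (t - u) * (e1 * (t - u))"
      by (simp_all add: power2_eq_square algebra_simps)
    have "g v - g t \<le> e1 * (v - t)"
      using uv(1) tuv by (cases "t = v") (auto simp: mult_le_cancel_left)
    moreover have "g t - g u \<le> e1 * (t - u)"
      using uv(2) tuv by (cases "t = u") (auto simp: mult_le_cancel_left)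
    ultimately show "g (Sup (snd i)) - g (Inf (snd i)) \<le> e1 * (Sup (snd i) - Inf (snd i))"
      by (simp add: u_def v_def algebra_simps)
  qed
  moreover have "(\<Sum>i\<in>p - q. e1 * (Sup (snd i) - Inf (snd i))) \<le> (\<Sum>i\<in>p. e1 * (Sup (snd i) - Inf (snd i)))"
    using cell \<open>e1 > 0\<close> fin by (intro sum_mono2) (force intro: mult_nonneg_nonneg order_trans)+
  moreover have "(\<Sum>i\<in>p. e1 * (Sup (snd i) - Inf (snd i))) = e1 * (b - a)"
    using additive_tagged_division_1[OF \<open>a \<le> b\<close> p(1), of "\<lambda>x. x"]
    by (simp add: sum_distrib_left[symmetric] case_prod_unfold)
  moreover have "(\<Sum>i\<in>p. g (Sup (snd i)) - g (Inf (snd i))) = g b - g a"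
    using additive_tagged_division_1[OF \<open>a \<le> b\<close> p(1), of g] by (simp add: case_prod_unfold)
  moreover have "(\<Sum>i\<in>p. g (Sup (snd i)) - g (Inf (snd i))) = (\<Sum>i\<in>p - q. g (Sup (snd i)) - g (Inf (snd i)))
      + (\<Sum>i\<in>q. g (Sup (snd i)) - g (Inf (snd i)))"
    using q fin by (intro sum.subset_diff) auto
  ultimately show "g b \<le> g a + e" using \<open>e1 * (b - a) \<le> e / 2\<close> by linarith
qed

section \<open>Sweeping processes\<close>

text \<open>Tychonoff's theorem. An uncountable product of compact sets need not be sequentially
  compact, so the limit is taken along a filter finer than \<open>sequentially\<close> instead of a
  subsequence. This suits step functions, which are not continuous.\<close>

lemma pointwise_cluster_point:
  fixes X :: "nat \<Rightarrow> 'b \<Rightarrow> 'a::topological_space"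
  assumes B: "\<And>t. compact (B t)" and X: "\<And>n t. X n t \<in> B t"
  obtains x G where "G \<noteq> bot" "G \<le> sequentially" "\<And>t. ((\<lambda>n. X n t) \<longlongrightarrow> x t) G"
proof -
  have "compactin (product_topology (\<lambda>_. euclidean) UNIV) (PiE UNIV B)"
    unfolding compactin_PiE using B by simp
  then have "compact (PiE UNIV B)"
    unfolding euclidean_product_topology by simp
  moreover have "filtermap X sequentially \<noteq> bot" "\<forall>\<^sub>F g in filtermap X sequentially. g \<in> PiE UNIV B"
    using X by (auto simp: filtermap_bot_iff eventually_filtermap intro!: always_eventually)
  ultimately obtain x where x: "inf (nhds x) (filtermap X sequentially) \<noteq> bot"
    unfolding compact_filter by blast
  \<comment> \<open>The large indices \<open>n\<close> for which \<open>X n\<close> is near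
    \<open>x\<close>; the filter is proper because \<open>x\<close> is a cluster point.\<close>
  define G where "G = inf sequentially (filtercomap X (nhds x))"
  have "G \<noteq> bot"
  proof
    assume "G = bot"
    then obtain P Q where PQ: "\<forall>\<^sub>F n in sequentially. P n" "eventually Q (nhds x)" "\<And>n. P n \<Longrightarrow> Q (X n) \<Longrightarrow> False"
      unfolding G_def trivial_limit_def eventually_inf eventually_filtercomap by blast
    have "\<forall>\<^sub>F g in filtermap X sequentially. \<not> Q g"
      unfolding eventually_filtermap using PQ(1) by (rule eventually_mono) (use PQ(3) in blast)
    then have "inf (nhds x) (filtermap X sequentially) = bot"
      unfolding trivial_limit_def eventually_inf using PQ(2) by blast
    with x show False by blast
  qed
  moreover have "((\<lambda>n. X n t) \<longlongrightarrow> x t) G" for t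
  proof -
    have "filterlim X (nhds x) G"
      unfolding G_def by (rule filterlim_mono[OF filterlim_filtercomap]) auto
    then have ev: "\<forall>\<^sub>F n in G. X n \<in> V" if "open V" "x \<in> V" for V
      using that by (auto simp: filterlim_iff intro: eventually_nhds_in_open)
    show ?thesis
    proof (rule topological_tendstoI)
      fix S :: "'a set" assume "open S" "x t \<in> S"
      then show "\<forall>\<^sub>F n in G. X n t \<in> S"
        using ev[OF open_vimage[OF \<open>open S\<close> continuous_on_product_coordinates, of t]] by simp
    qed
  qed
  ultimately show thesis using that[of G x] by (simp add: G_def)
qed

locale sweeping_process =
  fixes D :: "real \<Rightarrow> 'a::euclidean_space set" and f :: "real \<Rightarrow> 'a \<Rightarrow> 'a"
    and a b L cf :: real and x0 :: 'a
  assumes ab: "a < b"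
    and D: "\<And>t. t \<in> {a..b} \<Longrightarrow> closed (D t)" "\<And>t. t \<in> {a..b} \<Longrightarrow> convex (D t)" "\<And>t. t \<in> {a..b} \<Longrightarrow> D t \<noteq> {}"
    and L_nonneg: "L \<ge> 0"
    and D_lipschitz: "\<And>s t x. s \<in> {a..b} \<Longrightarrow> t \<in> {a..b} \<Longrightarrow> x \<in> D s \<Longrightarrow> \<exists>y\<in>D t. dist x y \<le> L * \<bar>s - t\<bar>"
    and f_cont: "continuous_on ({a..b} \<times> UNIV) (\<lambda>(t, x). f t x)"
    and cf_nonneg: "cf \<ge> 0"
    and f_growth: "\<And>t x. t \<in> {a..b} \<Longrightarrow> norm (f t x) \<le> cf * (1 + norm x)"
    and initial: "x0 \<in> D a"
begin

section \<open>Catching-up iterates and their a priori bounds\<close>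

definition proj :: "real \<Rightarrow> 'a \<Rightarrow> 'a" where "proj t = closest_point (D t)"

lemma proj_mem: "t \<in> {a..b} \<Longrightarrow> proj t y \<in> D t"
  unfolding proj_def using D by (intro closest_point_in_set)

lemma proj_inner: "t \<in> {a..b} \<Longrightarrow> z \<in> D t \<Longrightarrow> inner (y - proj t y) (z - proj t y) \<le> 0"
  unfolding proj_def using D by (intro closest_point_dot)

lemma proj_nonexpansive: "t \<in> {a..b} \<Longrightarrow> dist (proj t x) (proj t y) \<le> dist x y"
  unfolding proj_def using D by (intro closest_point_lipschitz)

lemma proj_dist:
  assumes "s \<in> {a..b}" "t \<in> {a..b}" "x \<in> D s" shows "dist x (proj t x) \<le> L * \<bar>s - t\<bar>"
proof -
  obtain y where "y \<in> D t" "dist x y \<le> L * \<bar>s - t\<bar>" using D_lipschitz[OF assms] by blast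
  then show ?thesis using closest_point_le[of "D t" y x] D(1)[OF assms(2)] by (simp add: proj_def)
qed

text \<open>Moreau's scheme: explicit Euler in the drift \<open>f\<close>, implicit Euler in the
  normal cone, since the projection is onto the set at the new time.\<close>

primrec catch_up :: "real \<Rightarrow> nat \<Rightarrow> 'a" where
  "catch_up h 0 = x0"
| "catch_up h (Suc k) = proj (a + real (Suc k) * h) (catch_up h k + h *\<^sub>R f (a + real k * h) (catch_up h k))"

text \<open>The discrete Gronwall constant: one step multiplies \<open>1 + norm x\<close> by at most
  \<open>1 + (cf + L) * h\<close>.\<close>

definition radius :: real where
  "radius = (1 + norm x0) * exp ((cf + L) * (b - a))"

definition speed :: real where "speed = cf * radius + L"

lemma radius_pos: "radius > 0"
  by (simp add: radius_def add_pos_nonneg)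

lemma speed_nonneg: "speed \<ge> 0"
  using cf_nonneg L_nonneg radius_pos by (simp add: speed_def)

lemma grid_mem: "h > 0 \<Longrightarrow> real k * h \<le> b - a \<Longrightarrow> a + real k * h \<in> {a..b}"
  by auto

lemma grid_pred: "h > 0 \<Longrightarrow> real (Suc k) * h \<le> b - a \<Longrightarrow> real k * h \<le> b - a"
  by (simp add: algebra_simps)

lemma catch_up_mem:
  assumes "h > 0" "real k * h \<le> b - a"
  shows "catch_up h k \<in> D (a + real k * h)"
proof (cases k)
  case 0
  then show ?thesis using initial by simp
next
  case (Suc m)
  then show ?thesis using grid_mem[OF assms] proj_mem by simp
qed

text \<open>Compare with the projection of the old iterate itself: nonexpansiveness charges the
  drift, and the motion of the set charges \<open>L * h\<close>.\<close>

lemma catch_up_step_aux: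
  assumes h: "h > 0" "real (Suc k) * h \<le> b - a"
  shows "norm (catch_up h (Suc k) - catch_up h k) \<le> h * (norm (f (a + real k * h) (catch_up h k)) + L)"
proof -
  let ?x = "catch_up h k" and ?t = "a + real (Suc k) * h"
  have t: "?t \<in> {a..b}" "a + real k * h \<in> {a..b}"
    using grid_mem[OF h] grid_mem[OF h(1) grid_pred[OF h]] by auto
  have "dist (catch_up h (Suc k)) (proj ?t ?x) \<le> h * norm (f (a + real k * h) ?x)"
    using proj_nonexpansive[OF t(1), of "?x + h *\<^sub>R f (a + real k * h) ?x" ?x] h(1)
    by (simp add: dist_norm)
  moreover have "dist ?x (proj ?t ?x) \<le> L * h"
    using proj_dist[OF t(2,1) catch_up_mem[OF h(1) grid_pred[OF h]]] h(1) by (simp add: algebra_simps)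
  ultimately have "dist (catch_up h (Suc k)) ?x \<le> h * norm (f (a + real k * h) ?x) + L * h"
    using dist_triangle2[of "catch_up h (Suc k)" ?x "proj ?t ?x"] by linarith
  then show ?thesis by (simp add: dist_norm algebra_simps)
qed

lemma catch_up_bound:
  assumes h: "h > 0" "real k * h \<le> b - a"
  shows "1 + norm (catch_up h k) \<le> radius"
proof -
  have "1 + norm (catch_up h k) \<le> (1 + norm x0) * exp ((cf + L) * (real k * h))"
    using h(2)
  proof (induction k)
    case (Suc k)
    let ?x = "catch_up h k" and ?c = "(cf + L) * h"
    have t: "a + real k * h \<in> {a..b}" using grid_mem[OF h(1) grid_pred[OF h(1) Suc.prems]] .
    have "norm (catch_up h (Suc k)) \<le> norm ?x + norm (catch_up h (Suc k) - ?x)"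
      by (rule norm_triangle_sub)
    also have "norm (catch_up h (Suc k) - ?x) \<le> h * (norm (f (a + real k * h) ?x) + L)"
      by (rule catch_up_step_aux[OF h(1) Suc.prems])
    \<comment> \<open>Enlarging \<open>L\<close> to \<open>L * (1 + norm ?x)\<close> merges drift
      and set motion into a single growth factor.\<close>
    also have "\<dots> \<le> h * (cf * (1 + norm ?x) + L * (1 + norm ?x))"
      using h(1) f_growth[OF t] L_nonneg
      by (intro mult_left_mono add_mono) (auto simp: algebra_simps)
    finally have "1 + norm (catch_up h (Suc k)) \<le> (1 + norm ?x) * (1 + ?c)"
      by (simp add: algebra_simps)
    also have "\<dots> \<le> (1 + norm ?x) * exp ?c"
      by (intro mult_left_mono exp_ge_add_one_self) simp
    also have "\<dots> \<le> ((1 + norm x0) * exp ((cf + L) * (real k * h))) * exp ?c"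
      using Suc.IH[OF grid_pred[OF h(1) Suc.prems]] by (intro mult_right_mono) auto
    also have "\<dots> = (1 + norm x0) * exp ((cf + L) * (real (Suc k) * h))"
      by (simp add: exp_add[symmetric] algebra_simps)
    finally show ?case .
  qed simp
  also have "\<dots> \<le> radius"
    unfolding radius_def using h cf_nonneg L_nonneg by (intro mult_left_mono) (auto intro: mult_left_mono)
  finally show ?thesis .
qed

lemma f_catch_up_bound:
  assumes h: "h > 0" "real k * h \<le> b - a"
  shows "norm (f (a + real k * h) (catch_up h k)) + L \<le> speed"
proof -
  have "norm (f (a + real k * h) (catch_up h k)) \<le> cf * (1 + norm (catch_up h k))"
    by (rule f_growth[OF grid_mem[OF h]])
  also have "\<dots> \<le> cf * radius" using catch_up_bound[OF h] cf_nonneg by (rule mult_left_mono)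
  finally show ?thesis by (simp add: speed_def)
qed

lemma catch_up_step:
  assumes h: "h > 0" "real (Suc k) * h \<le> b - a"
  shows "norm (catch_up h (Suc k) - catch_up h k) \<le> h * speed"
  using catch_up_step_aux[OF h] f_catch_up_bound[OF h(1) grid_pred[OF h]] h(1)
  by (smt (verit) mult_left_mono)

lemma catch_up_lipschitz:
  assumes h: "h > 0" and "j \<le> k" "real k * h \<le> b - a"
  shows "norm (catch_up h k - catch_up h j) \<le> speed * (real (k - j) * h)"
  using assms(2,3)
proof (induction k rule: dec_induct)
  case (step k)
  have "norm (catch_up h (Suc k) - catch_up h j)
      \<le> norm (catch_up h (Suc k) - catch_up h k) + norm (catch_up h k - catch_up h j)"
    using norm_triangle_ineq[of "catch_up h (Suc k) - catch_up h k" "catch_up h k - catch_up h j"] by simp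
  also have "\<dots> \<le> h * speed + speed * (real (k - j) * h)"
    using catch_up_step[OF h step.prems] step.IH[OF grid_pred[OF h step.prems]] by linarith
  also have "\<dots> = speed * (real (Suc k - j) * h)"
    using step.hyps by (simp add: Suc_diff_le algebra_simps)
  finally show ?case .
qed simp

text \<open>The projection inequality holds for the set at the new grid time and the new iterate.
  Here they are replaced by \<open>D t\<close> and \<open>y\<close>, and the drift by
  \<open>F\<close>. The first two replacements are paid by the residual, of norm at most
  \<open>2 * h * speed\<close>, times \<open>L * \<eta> + \<rho>\<close>, the third by \<omega>.
  Every error is proportional to \<open>h\<close>, so the steps can be summed.\<close>

lemma catch_up_step_inner:
  assumes h: "h > 0" "real (Suc k) * h \<le> b - a"
    and t: "t \<in> {a..b}" "\<bar>t - (a + real (Suc k) * h)\<bar> \<le> \<eta>" and z: "z \<in> D t"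
    and y: "norm (catch_up h (Suc k) - y) \<le> \<rho>"
    and F: "norm (f (a + real k * h) (catch_up h k) - F) \<le> \<omega>"
  shows "inner (catch_up h k - catch_up h (Suc k) + h *\<^sub>R F) (z - y)
      \<le> h * (2 * speed * (L * \<eta> + \<rho>) + \<omega> * norm (z - y))"
proof -
  let ?x = "catch_up h k" and ?x' = "catch_up h (Suc k)" and ?t = "a + real (Suc k) * h"
  let ?f = "f (a + real k * h) ?x"
  \<comment> \<open>What the projection removes in this step, a normal vector to the new set at the
    new iterate.\<close>
  define r where "r = ?x + h *\<^sub>R ?f - ?x'"
  have t': "?t \<in> {a..b}" by (rule grid_mem[OF h])
  have "norm r \<le> norm (?x' - ?x) + h * norm ?f"
    using norm_triangle_ineq4[of "h *\<^sub>R ?f" "?x' - ?x"] h(1) by (simp add: r_def algebra_simps)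
  also have "\<dots> \<le> h * speed + h * speed"
    using catch_up_step[OF h] f_catch_up_bound[OF h(1) grid_pred[OF h]] h(1) L_nonneg
    by (intro add_mono mult_left_mono) auto
  finally have r: "norm r \<le> h * (2 * speed)" by simp
  have zz: "norm (z - proj ?t z) \<le> L * \<eta>"
    using proj_dist[OF t(1) t' z] mult_left_mono[OF t(2) L_nonneg] by (simp add: dist_norm)
  have "inner r (proj ?t z - ?x') \<le> 0"
    using proj_inner[OF t' proj_mem[OF t']] by (simp add: r_def)
  moreover have "inner r (z - proj ?t z) \<le> norm r * norm (z - proj ?t z)" by (rule norm_cauchy_schwarz)
  moreover have "inner r (?x' - y) \<le> norm r * norm (?x' - y)" by (rule norm_cauchy_schwarz)
  moreover have "norm r * norm (z - proj ?t z) + norm r * norm (?x' - y) \<le> h * (2 * speed) * (L * \<eta> + \<rho>)"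
    using r zz y h(1) speed_nonneg by (subst distrib_left[symmetric], intro mult_mono) auto
  moreover have "inner r (z - y) = inner r (z - proj ?t z) + inner r (proj ?t z - ?x') + inner r (?x' - y)"
    by (simp add: inner_diff_right)
  ultimately have "inner r (z - y) \<le> h * (2 * speed) * (L * \<eta> + \<rho>)" by linarith
  moreover have "inner (F - ?f) (z - y) \<le> \<omega> * norm (z - y)"
    using norm_cauchy_schwarz[of "F - ?f" "z - y"] mult_right_mono[OF F, of "norm (z - y)"]
    by (simp add: norm_minus_commute)
  then have "h * inner (F - ?f) (z - y) \<le> h * (\<omega> * norm (z - y))"
    using h(1) by (intro mult_left_mono) auto
  moreover have "inner (?x - ?x' + h *\<^sub>R F) (z - y) = inner r (z - y) + h * inner (F - ?f) (z - y)"
    unfolding r_def inner_scaleR_left[symmetric] inner_add_left[symmetric] by (simp add: algebra_simps)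
  ultimately show ?thesis by (simp add: algebra_simps)
qed

text \<open>The test vector \<open>z - y\<close> is the same in every step, so the left-hand sides
  telescope.\<close>

lemma catch_up_inner:
  assumes h: "h > 0" and "j \<le> m" and "real m * h \<le> b - a"
    and t: "t \<in> {a..b}" and z: "z \<in> D t"
    and near: "\<And>k. j \<le> k \<Longrightarrow> k < m \<Longrightarrow> \<bar>t - (a + real (Suc k) * h)\<bar> \<le> \<eta>"
    and y: "\<And>k. j \<le> k \<Longrightarrow> k < m \<Longrightarrow> norm (catch_up h (Suc k) - y) \<le> \<rho>"
    and F: "\<And>k. j \<le> k \<Longrightarrow> k < m \<Longrightarrow> norm (f (a + real k * h) (catch_up h k) - F) \<le> \<omega>"
  shows "inner (catch_up h j - catch_up h m + (real (m - j) * h) *\<^sub>R F) (z - y)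
      \<le> real (m - j) * h * (2 * speed * (L * \<eta> + \<rho>) + \<omega> * norm (z - y))"
  using assms(2,3) near y F
proof (induction m rule: dec_induct)
  case (step m)
  let ?Q = "2 * speed * (L * \<eta> + \<rho>) + \<omega> * norm (z - y)"
  have "inner (catch_up h j - catch_up h m + (real (m - j) * h) *\<^sub>R F) (z - y) \<le> real (m - j) * h * ?Q"
    using step.prems grid_pred[OF h step.prems(1)] by (intro step.IH) auto
  moreover have "inner (catch_up h m - catch_up h (Suc m) + h *\<^sub>R F) (z - y) \<le> h * ?Q"
    using step.prems step.hyps by (intro catch_up_step_inner[OF h _ t _ z]) auto
  moreover have "catch_up h j - catch_up h (Suc m) + (real (Suc m - j) * h) *\<^sub>R F
      = (catch_up h j - catch_up h m + (real (m - j) * h) *\<^sub>R F) + (catch_up h m - catch_up h (Suc m) + h *\<^sub>R F)"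
    using step.hyps by (simp add: Suc_diff_le scaleR_add_left algebra_simps)
  moreover have "real (Suc m - j) * h * ?Q = real (m - j) * h * ?Q + h * ?Q"
    using step.hyps by (simp add: Suc_diff_le algebra_simps)
  ultimately show ?case by (simp only: inner_add_left)
qed simp

section \<open>Step-function approximations and their limit\<close>

definition mesh :: "nat \<Rightarrow> real" where "mesh n = (b - a) / real (Suc n)"

definition index :: "nat \<Rightarrow> real \<Rightarrow> nat" where "index n t = nat \<lfloor>(t - a) / mesh n\<rfloor>"

text \<open>Piecewise constant rather than interpolated, so that every value is an iterate and lies
  in the moving set at its grid time.\<close>

definition approx :: "nat \<Rightarrow> real \<Rightarrow> 'a" where "approx n t = catch_up (mesh n) (index n t)"

lemma mesh_pos: "mesh n > 0"
  using ab by (simp add: mesh_def)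

lemma mesh_tendsto: "mesh \<longlonglongrightarrow> 0"
proof -
  have "(\<lambda>n. (b - a) / real (Suc n)) \<longlonglongrightarrow> 0"
    using tendsto_mult_right_zero[OF LIMSEQ_inverse_real_of_nat, of "b - a"]
    by (simp add: divide_inverse)
  then show ?thesis by (simp add: mesh_def[abs_def])
qed

lemma index_bounds:
  assumes "t \<ge> a"
  shows "a + real (index n t) * mesh n \<le> t" "t < a + real (Suc (index n t)) * mesh n"
proof -
  have *: "0 \<le> \<lfloor>(t - a) / mesh n\<rfloor>" using assms mesh_pos[of n] by simp
  then have "real (index n t) = of_int \<lfloor>(t - a) / mesh n\<rfloor>" by (simp add: index_def)
  then have "real (index n t) \<le> (t - a) / mesh n" "(t - a) / mesh n < real (Suc (index n t))"
    by (simp_all add: of_int_floor_le) linarith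
  then show "a + real (index n t) * mesh n \<le> t" "t < a + real (Suc (index n t)) * mesh n"
    using mesh_pos[of n] by (simp_all add: field_simps)
qed

lemma index_mono: "s \<le> t \<Longrightarrow> index n s \<le> index n t"
  unfolding index_def using mesh_pos[of n] by (intro nat_mono floor_mono divide_right_mono) auto

text \<open>The extra mesh term pays for the jumps, as two nearby times may straddle a grid point;
  it vanishes in the limit.\<close>

lemma approx_lipschitz:
  assumes "a \<le> s" "s \<le> t" "t \<le> b"
  shows "norm (approx n t - approx n s) \<le> speed * ((t - s) + mesh n)"
proof -
  have b: "real (index n t) * mesh n \<le> b - a" using index_bounds(1)[of t n] assms by linarith
  have "norm (approx n t - approx n s) \<le> speed * (real (index n t - index n s) * mesh n)"
    unfolding approx_def by (rule catch_up_lipschitz[OF mesh_pos index_mono[OF assms(2)] b])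
  also have "real (index n t - index n s) * mesh n = real (index n t) * mesh n - real (index n s) * mesh n"
    using index_mono[OF assms(2)] by (simp add: of_nat_diff left_diff_distrib)
  also have "speed * \<dots> \<le> speed * ((t - s) + mesh n)"
    using index_bounds(1)[of t n] index_bounds(2)[of s n] assms speed_nonneg
    by (intro mult_left_mono) (auto simp: algebra_simps)
  finally show ?thesis .
qed

lemma approx_near_D:
  assumes "t \<in> {a..b}"
  shows "dist (approx n t) (proj t (approx n t)) \<le> L * mesh n"
proof -
  have b: "real (index n t) * mesh n \<le> b - a" using index_bounds(1)[of t n] assms by auto
  have "dist (approx n t) (proj t (approx n t)) \<le> L * \<bar>a + real (index n t) * mesh n - t\<bar>"
    unfolding approx_def
    by (rule proj_dist[OF grid_mem[OF mesh_pos b] assms catch_up_mem[OF mesh_pos b]])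
  also have "\<dots> \<le> L * mesh n"
    using index_bounds[of t n] assms L_nonneg by (intro mult_left_mono) (auto simp: algebra_simps)
  finally show ?thesis .
qed

lemma approx_bounded:
  assumes "t \<in> {a..b}" shows "approx n t \<in> cball 0 radius"
proof -
  have b: "real (index n t) * mesh n \<le> b - a" using index_bounds(1)[of t n] assms by auto
  then show ?thesis using catch_up_bound[OF mesh_pos[of n] b] by (simp add: approx_def)
qed

lemma approx_initial: "approx n a = x0"
  by (simp add: approx_def index_def)

text \<open>The summed inequality on \<open>[t, t + \<eta>]\<close>: the speed bound keeps every
  iterate there close to \<open>y\<close>, so the drift may be frozen at \<open>F\<close>.\<close>

lemma approx_inner:
  assumes t: "a \<le> t" "0 \<le> \<eta>" "t + \<eta> \<le> b" and z: "z \<in> D t"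
    and near: "\<eta> + mesh n < d" "speed * (\<eta> + mesh n) + norm (approx n t - y) < d"
    and F: "\<And>s x. s \<in> {a..b} \<Longrightarrow> \<bar>s - t\<bar> < d \<Longrightarrow> norm (x - y) < d \<Longrightarrow> norm (f s x - F) \<le> \<omega>"
  shows "inner (approx n t - approx n (t + \<eta>) + (real (index n (t + \<eta>) - index n t) * mesh n) *\<^sub>R F) (z - y)
      \<le> real (index n (t + \<eta>) - index n t) * mesh n *
        (2 * speed * (L * \<eta> + (speed * (\<eta> + mesh n) + norm (approx n t - y))) + \<omega> * norm (z - y))"
proof -
  let ?h = "mesh n" and ?j = "index n t" and ?m = "index n (t + \<eta>)"
  note h = mesh_pos[of n]
  have jm: "?j \<le> ?m" using t by (intro index_mono) auto
  have m: "real ?m * ?h \<le> t + \<eta> - a" using index_bounds(1)[of "t + \<eta>" n] t by auto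
  have j: "real ?j * ?h \<le> t - a" "t - a < real ?j * ?h + ?h"
    using index_bounds[of t n] t by (auto simp: algebra_simps)
  have close: "norm (catch_up ?h k - y) \<le> speed * (\<eta> + ?h) + norm (approx n t - y)" if k: "?j \<le> k" "k \<le> ?m" for k
  proof -
    have kh: "real k * ?h \<le> real ?m * ?h" using k h by (intro mult_right_mono) auto
    have "norm (catch_up ?h k - catch_up ?h ?j) \<le> speed * (real (k - ?j) * ?h)"
      using kh m t by (intro catch_up_lipschitz[OF h k(1)]) auto
    also have "real (k - ?j) * ?h = real k * ?h - real ?j * ?h"
      using k by (simp add: of_nat_diff left_diff_distrib)
    also have "speed * \<dots> \<le> speed * (\<eta> + ?h)"
      using kh m j by (intro mult_left_mono speed_nonneg) linarith
    finally show ?thesis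
      using norm_triangle_ineq[of "catch_up ?h k - catch_up ?h ?j" "catch_up ?h ?j - y"]
      by (simp add: approx_def)
  qed
  have times: "real ?j * ?h \<le> real k * ?h" "real k * ?h + ?h \<le> real ?m * ?h" if "?j \<le> k" "k < ?m" for k
    using that h mult_right_mono[of "real (Suc k)" "real ?m" ?h]
    by (auto simp: distrib_right intro: mult_right_mono)
  show ?thesis
    unfolding approx_def
  proof (rule catch_up_inner[OF h jm _ _ z])
    show "real ?m * ?h \<le> b - a" "t \<in> {a..b}" using m t by auto
    fix k assume k: "?j \<le> k" "k < ?m"
    \<comment> \<open>Grid time number \<open>Suc k\<close> already lies after \<open>t\<close>, so
      no mesh term appears. Time number \<open>k\<close> in the drift may precede \<open>t\<close>
      by up to one mesh, hence the mesh in \<open>near\<close>.\<close>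
    show "\<bar>t - (a + real (Suc k) * ?h)\<bar> \<le> \<eta>"
      using times[OF k] m j t unfolding abs_le_iff of_nat_Suc distrib_right by linarith
    show "norm (catch_up ?h (Suc k) - y) \<le> speed * (\<eta> + ?h) + norm (catch_up ?h ?j - y)"
      using close[of "Suc k"] k by (simp add: approx_def)
    have "norm (catch_up ?h k - y) < d"
      using close[of k] k near(2) by simp
    then show "norm (f (a + real k * ?h) (catch_up ?h k) - F) \<le> \<omega>"
    proof (rule F[rotated -1])
      have "0 \<le> real k * ?h" using h by simp
      then show "a + real k * ?h \<in> {a..b}" "\<bar>a + real k * ?h - t\<bar> < d"
        using times[OF k] m j t near(1) h
        unfolding abs_less_iff atLeastAtMost_iff by (linarith, linarith)
    qed
  qed
qed

lemma steps_between:
  assumes "a \<le> t" "0 \<le> \<eta>"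
  shows "\<bar>real (index n (t + \<eta>) - index n t) * mesh n - \<eta>\<bar> \<le> mesh n"
proof -
  have "index n t \<le> index n (t + \<eta>)" using assms by (intro index_mono) auto
  then show ?thesis
    using index_bounds[of t n] index_bounds[of "t + \<eta>" n] assms
    by (auto simp: of_nat_diff abs_le_iff algebra_simps)
qed

text \<open>Pointwise convergence along a filter suffices, because each difference quotient of the limit
  only involves finitely many values; no convergence of the velocities is needed.\<close>

theorem solution_exists:
  obtains x where "speed-lipschitz_on {a..b} x" "x a = x0" "\<And>t. t \<in> {a..b} \<Longrightarrow> x t \<in> D t"
    "\<And>t v z. t \<in> {a<..<b} \<Longrightarrow> (x has_vector_derivative v) (at t) \<Longrightarrow> z \<in> D t \<Longrightarrow>
      inner (f t (x t) - v) (z - x t) \<le> 0"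
proof -
  \<comment> \<open>The constant extension puts all values, for every real time, in one compact
    ball.\<close>
  define X where "X n t = (if t \<in> {a..b} then approx n t else x0)" for n t
  have "X n t \<in> cball 0 (max radius (norm x0))" for n t
    using approx_bounded[of t n] by (auto simp: X_def le_max_iff_disj)
  then obtain x G where G: "G \<noteq> bot" "G \<le> sequentially" and X: "\<And>t. ((\<lambda>n. X n t) \<longlongrightarrow> x t) G"
    using pointwise_cluster_point[of "\<lambda>_. cball 0 (max radius (norm x0))" X] compact_cball by metis
  have lim[tendsto_intros]: "((\<lambda>n. approx n t) \<longlongrightarrow> x t) G" if "t \<in> {a..b}" for t
    using X[of t] that by (simp add: X_def)
  have mesh_lim[tendsto_intros]: "(mesh \<longlongrightarrow> 0) G" using mesh_tendsto G(2) by (rule tendsto_mono[rotated])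
  have lip: "norm (x t - x s) \<le> speed * (t - s)" if "a \<le> s" "s \<le> t" "t \<le> b" for s t
  proof (rule tendsto_le[OF G(1)])
    show "((\<lambda>n. speed * ((t - s) + mesh n)) \<longlongrightarrow> speed * (t - s)) G"
      by (rule tendsto_eq_intros mesh_lim refl | simp)+
    show "((\<lambda>n. norm (approx n t - approx n s)) \<longlongrightarrow> norm (x t - x s)) G"
      using that by (intro tendsto_intros) auto
  qed (use approx_lipschitz[OF that] in simp)
  have mem: "x t \<in> D t" if t: "t \<in> {a..b}" for t
  proof -
    have "((\<lambda>n. dist (approx n t) (proj t (approx n t))) \<longlongrightarrow> 0) G"
    proof (rule tendsto_sandwich)
      show "\<forall>\<^sub>F n in G. 0 \<le> dist (approx n t) (proj t (approx n t))" by simp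
      show "\<forall>\<^sub>F n in G. dist (approx n t) (proj t (approx n t)) \<le> L * mesh n"
        using approx_near_D[OF t] by simp
      show "((\<lambda>n. L * mesh n) \<longlongrightarrow> 0) G" using tendsto_mult_right_zero[OF mesh_lim] .
    qed simp
    then have "((\<lambda>n. approx n t - proj t (approx n t)) \<longlongrightarrow> 0) G"
      unfolding dist_norm by (rule tendsto_norm_zero_cancel)
    from tendsto_diff[OF lim[OF t] this] have "((\<lambda>n. proj t (approx n t)) \<longlongrightarrow> x t) G"
      by simp
    then show ?thesis
      using proj_mem[OF t] by (intro Lim_in_closed_set[OF D(1)[OF t] _ G(1)]) auto
  qed
  have inner_eps: "inner (f t (x t) - v) (z - x t) \<le> \<epsilon>"
    if t: "t \<in> {a<..<b}" and v: "(x has_vector_derivative v) (at t)" and z: "z \<in> D t" and \<epsilon>: "\<epsilon> > 0" for t v z \<epsilon>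
  proof -
    let ?F = "f t (x t)" and ?w = "z - x t"
    \<comment> \<open>The tolerance on the drift for which its contribution stays within
      \<epsilon>.\<close>
    define \<omega> where "\<omega> = \<epsilon> / (norm ?w + 1)"
    have \<omega>: "\<omega> > 0" "\<omega> * norm ?w \<le> \<epsilon>"
      using \<epsilon> by (auto simp: \<omega>_def field_simps add_pos_nonneg)
    have "(t, x t) \<in> {a..b} \<times> UNIV" using t by auto
    with f_cont \<omega>(1) obtain d where d: "d > 0"
      "\<And>s y. s \<in> {a..b} \<Longrightarrow> dist (s, y) (t, x t) < d \<Longrightarrow> dist (f s y) ?F < \<omega>"
      unfolding continuous_on_iff by fastforce
    have F: "norm (f s y - ?F) \<le> \<omega>" if "s \<in> {a..b}" "\<bar>s - t\<bar> < d / 2" "norm (y - x t) < d / 2" for s y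
    proof -
      have "dist (s, y) (t, x t) \<le> dist s t + dist y (x t)"
        unfolding dist_prod_def by (simp add: sqrt_sum_squares_le_sum)
      with that d(2)[of s y] show ?thesis by (simp add: dist_norm)
    qed
    \<comment> \<open>The filter limit is taken with \<eta> fixed; \<eta> tends to 0 only
      afterwards. Forward quotients suffice because \<open>v\<close> is a two-sided
      derivative.\<close>
    have quot: "inner (?F - (x (t + \<eta>) - x t) /\<^sub>R \<eta>) ?w \<le> 2 * speed * (L * \<eta> + speed * \<eta>) + \<omega> * norm ?w"
      if \<eta>: "0 < \<eta>" "t + \<eta> \<le> b" "\<eta> < d / 2" "speed * \<eta> < d / 2" for \<eta>
    proof -
      \<comment> \<open>The time actually covered by the grid steps between \<open>t\<close> and
        \<open>t + \<eta>\<close>; it differs from \<eta> by at most one mesh.\<close>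
      define k where "k n = real (index n (t + \<eta>) - index n t) * mesh n" for n
      have "((\<lambda>n. k n - \<eta>) \<longlongrightarrow> 0) G"
        by (rule tendsto_0_le[OF mesh_lim, of _ 1]) (use steps_between[of t \<eta>] t \<eta> mesh_pos in \<open>auto simp: k_def less_imp_le\<close>)
      then have k[tendsto_intros]: "(k \<longlongrightarrow> \<eta>) G" by (simp add: Lim_null[symmetric])
      have l: "((\<lambda>n. approx n t) \<longlongrightarrow> x t) G" "((\<lambda>n. approx n (t + \<eta>)) \<longlongrightarrow> x (t + \<eta>)) G"
        using t \<eta> by (auto intro!: lim)
      have n: "((\<lambda>n. norm (approx n t - x t)) \<longlongrightarrow> 0) G"
        using l(1) by (simp add: Lim_null[symmetric] tendsto_norm_zero_iff)
      have "((\<lambda>n. speed * (\<eta> + mesh n) + norm (approx n t - x t)) \<longlongrightarrow> speed * (\<eta> + 0) + 0) G"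
        by (intro tendsto_intros n)
      then have "\<forall>\<^sub>F n in G. speed * (\<eta> + mesh n) + norm (approx n t - x t) < d / 2"
        by (rule order_tendstoD) (use \<eta> in simp)
      moreover have "((\<lambda>n. \<eta> + mesh n) \<longlongrightarrow> \<eta> + 0) G" by (intro tendsto_intros)
      then have "\<forall>\<^sub>F n in G. \<eta> + mesh n < d / 2"
        by (rule order_tendstoD) (use \<eta> in simp)
      ultimately have ev: "\<forall>\<^sub>F n in G. inner (approx n t - approx n (t + \<eta>) + k n *\<^sub>R ?F) ?w
          \<le> k n * (2 * speed * (L * \<eta> + (speed * (\<eta> + mesh n) + norm (approx n t - x t))) + \<omega> * norm ?w)"
        unfolding k_def
        by eventually_elim (rule approx_inner[where d = "d / 2"], use t \<eta> z F in auto)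
      have "inner (x t - x (t + \<eta>) + \<eta> *\<^sub>R ?F) ?w
          \<le> \<eta> * (2 * speed * (L * \<eta> + (speed * (\<eta> + 0) + 0)) + \<omega> * norm ?w)"
        by (rule tendsto_le[OF G(1) _ _ ev]) (intro tendsto_intros n l)+
      moreover have "inner (?F - (x (t + \<eta>) - x t) /\<^sub>R \<eta>) ?w = inner (x t - x (t + \<eta>) + \<eta> *\<^sub>R ?F) ?w / \<eta>"
        using \<eta>(1) by (simp add: inner_add_left inner_diff_left divide_simps)
      ultimately show ?thesis using \<eta>(1) by (simp only: pos_divide_le_eq add_0_right mult.commute)
    qed
    have "((\<lambda>\<eta>. norm (x (t + \<eta>) - x t - \<eta> *\<^sub>R v) / norm \<eta>) \<longlongrightarrow> 0) (at_right 0)"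
      using v unfolding has_vector_derivative_def has_derivative_at
      by (auto intro: tendsto_within_subset)
    moreover have "\<forall>\<^sub>F \<eta> in at_right (0::real). norm (x (t + \<eta>) - x t - \<eta> *\<^sub>R v) / norm \<eta>
        = norm ((x (t + \<eta>) - x t) /\<^sub>R \<eta> - v)"
      using eventually_at_right_less
    proof eventually_elim
      case (elim \<eta>)
      then have "(x (t + \<eta>) - x t) /\<^sub>R \<eta> - v = (x (t + \<eta>) - x t - \<eta> *\<^sub>R v) /\<^sub>R \<eta>"
        by (simp add: scaleR_diff_right)
      then show ?case by (simp add: divide_inverse mult.commute)
    qed
    ultimately have "((\<lambda>\<eta>. norm ((x (t + \<eta>) - x t) /\<^sub>R \<eta> - v)) \<longlongrightarrow> 0) (at_right 0)"
      by (rule Lim_transform_eventually)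
    then have "((\<lambda>\<eta>. (x (t + \<eta>) - x t) /\<^sub>R \<eta>) \<longlongrightarrow> v) (at_right 0)"
      by (simp add: tendsto_norm_zero_iff LIM_zero_iff)
    then have "((\<lambda>\<eta>. inner (?F - (x (t + \<eta>) - x t) /\<^sub>R \<eta>) ?w) \<longlongrightarrow> inner (?F - v) ?w) (at_right 0)"
      by (intro tendsto_intros)
    moreover have "((\<lambda>\<eta>. 2 * speed * (L * \<eta> + speed * \<eta>) + \<omega> * norm ?w) \<longlongrightarrow> 2 * speed * (L * 0 + speed * 0) + \<omega> * norm ?w) (at_right 0)"
      by (intro tendsto_intros)
    moreover have "\<forall>\<^sub>F \<eta> in at_right 0. inner (?F - (x (t + \<eta>) - x t) /\<^sub>R \<eta>) ?w \<le> 2 * speed * (L * \<eta> + speed * \<eta>) + \<omega> * norm ?w"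
    proof -
      \<comment> \<open>The quotient by \<open>speed + 1\<close> ensures
        \<open>speed * \<eta> < d / 2\<close> even if the speed is 0.\<close>
      define c where "c = min (b - t) (min (d / 2) (d / 2 / (speed + 1)))"
      have "c > 0" using t d(1) speed_nonneg by (simp add: c_def)
      then have "\<forall>\<^sub>F \<eta> in at_right 0. \<eta> \<in> {0<..<c}" by (rule eventually_at_right_real)
      then show ?thesis
      proof eventually_elim
        case (elim \<eta>)
        then have "\<eta> * (speed + 1) < d / 2" using speed_nonneg by (simp add: c_def pos_less_divide_eq algebra_simps)
        then show ?case using elim by (intro quot) (auto simp: c_def algebra_simps)
      qed
    qed
    ultimately have "inner (?F - v) ?w \<le> 2 * speed * (L * 0 + speed * 0) + \<omega> * norm ?w"
      by (intro tendsto_le[OF _ _ _]) auto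
    then show ?thesis using \<omega>(2) by simp
  qed
  show thesis
  proof (rule that[of x])
    show "speed-lipschitz_on {a..b} x"
    proof (rule lipschitz_onI)
      fix s t assume "s \<in> {a..b}" "t \<in> {a..b}"
      then show "dist (x s) (x t) \<le> speed * dist s t"
        using lip[of s t] lip[of t s] by (cases "s \<le> t") (auto simp: dist_norm norm_minus_commute)
    qed (rule speed_nonneg)
    show "x a = x0"
      using tendsto_unique[OF G(1) lim[of a]] ab by (auto simp: approx_initial)
  qed (use mem inner_eps in \<open>auto intro: field_le_epsilon\<close>)
qed

end

section \<open>Solutions of differential inclusions\<close>

lemma AE_lebesgue_on_iff_negligible:
  assumes "S \<in> sets lebesgue"
  shows "(AE t in lebesgue_on S. P t) \<longleftrightarrow> (\<exists>N. negligible N \<and> (\<forall>t\<in>S - N. P t))"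
proof -
  have "(AE t in lebesgue_on S. P t) \<longleftrightarrow> (AE t in lebesgue. t \<in> S \<longrightarrow> P t)"
    using assms by (intro AE_restrict_space_iff) simp
  also have "\<dots> \<longleftrightarrow> (\<exists>N. negligible N \<and> (\<forall>t\<in>S - N. P t))"
    unfolding eventually_ae_filter_negligible by blast
  finally show ?thesis .
qed

lemma absolutely_continuous_on_interval_subset:
  assumes "absolutely_continuous_on_interval a b x" "a \<le> c" "d \<le> b"
  shows "absolutely_continuous_on_interval c d x"
  unfolding absolutely_continuous_on_interval_def
proof (intro allI impI)
  fix e :: real assume "e > 0"
  obtain \<delta> where \<delta>: "\<delta> > 0"
    "\<And>(n::nat) u v. (\<And>i. i < n \<Longrightarrow> a \<le> u i \<and> u i \<le> v i \<and> v i \<le> b) \<Longrightarrow>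
        disjoint_family_on (\<lambda>i. {u i<..<v i}) {..<n} \<Longrightarrow> (\<Sum>i<n. v i - u i) < \<delta> \<Longrightarrow>
        (\<Sum>i<n. norm (x (v i) - x (u i))) < e"
    using absolutely_continuous_on_intervalE[OF assms(1) \<open>e > 0\<close>] by blast
  show "\<exists>\<delta>>0. \<forall>(n::nat) u v. (\<forall>i<n. c \<le> u i \<and> u i \<le> v i \<and> v i \<le> d) \<and>
      disjoint_family_on (\<lambda>i. {u i<..<v i}) {..<n} \<and> (\<Sum>i<n. v i - u i) < \<delta> \<longrightarrow>
      (\<Sum>i<n. norm (x (v i) - x (u i))) < e"
  proof (intro exI conjI allI impI)
    fix n :: nat and u v
    assume "(\<forall>i<n. c \<le> u i \<and> u i \<le> v i \<and> v i \<le> d) \<and>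
      disjoint_family_on (\<lambda>i. {u i<..<v i}) {..<n} \<and> (\<Sum>i<n. v i - u i) < \<delta>"
    then show "(\<Sum>i<n. norm (x (v i) - x (u i))) < e"
      using assms(2,3) by (intro \<delta>(2)) force+
  qed (rule \<delta>(1))
qed

lemma exp_neg_lipschitz:
  fixes p q :: real
  assumes "0 \<le> p" "p \<le> q"
  shows "\<bar>exp (- q) - exp (- p)\<bar> \<le> q - p"
proof -
  have "exp (- p) - exp (- q) = exp (- p) * (1 - exp (p - q))"
    by (simp add: algebra_simps flip: exp_add)
  also have "\<dots> \<le> 1 * (q - p)"
  proof (rule mult_mono)
    show "1 - exp (p - q) \<le> q - p" using exp_ge_add_one_self[of "p - q"] by linarith
  qed (use assms in auto)
  finally show ?thesis using assms by simp
qed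

text \<open>The weight \<open>exp (- 2 * c * (s - t0))\<close> turns Gronwall's inequality into a
  sign condition on a derivative, so the monotonicity result for absolutely continuous functions
  applies. Both solutions are bounded, so one constant of the one-sided Lipschitz condition serves
  for the whole interval.\<close>

lemma inclusion_solution_unique:
  fixes x y :: "real \<Rightarrow> 'a::euclidean_space"
  assumes x: "inclusion_solution F t0 T x0 x" and y: "inclusion_solution F t0 T x0 y"
    and mono: "\<And>M. \<exists>c. \<forall>t\<in>{t0..T}. \<forall>x1 x2 v1 v2. norm x1 \<le> M \<longrightarrow> norm x2 \<le> M \<longrightarrow>
        v1 \<in> F t x1 \<longrightarrow> v2 \<in> F t x2 \<longrightarrow> inner (v1 - v2) (x1 - x2) \<le> c * (norm (x1 - x2))\<^sup>2"
    and t: "t \<in> {t0..T}"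
  shows "x t = y t"
proof -
  have acx: "absolutely_continuous_on_interval t0 t x" and acy: "absolutely_continuous_on_interval t0 t y"
    using x y t unfolding inclusion_solution_def
    by (auto intro: absolutely_continuous_on_interval_subset)
  have "bounded (x ` {t0..t} \<union> y ` {t0..t})"
    using acx acy
    by (auto intro!: compact_imp_bounded compact_continuous_image absolutely_continuous_on_interval_imp_continuous_on)
  then obtain M where M: "M > 0" "\<And>s. s \<in> {t0..t} \<Longrightarrow> norm (x s) \<le> M" "\<And>s. s \<in> {t0..t} \<Longrightarrow> norm (y s) \<le> M"
    unfolding bounded_pos by blast
  obtain c0 where c0: "\<And>s x1 x2 v1 v2. s \<in> {t0..T} \<Longrightarrow> norm x1 \<le> M \<Longrightarrow> norm x2 \<le> M \<Longrightarrow>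
      v1 \<in> F s x1 \<Longrightarrow> v2 \<in> F s x2 \<Longrightarrow> inner (v1 - v2) (x1 - x2) \<le> c0 * (norm (x1 - x2))\<^sup>2"
    using mono[of M] by blast
  \<comment> \<open>The absolute value keeps the exponent nonpositive, so the weight is at most 1
    and Lipschitz.\<close>
  define c where "c = \<bar>c0\<bar>"
  define w where "w s = x s - y s" for s
  define E where "E s = exp (- (2 * c * (s - t0)))" for s
  define g where "g s = E s * inner (w s) (w s)" for s
  have w: "norm (w s) \<le> 2 * M" if "s \<in> {t0..t}" for s
    unfolding w_def using norm_triangle_ineq4[of "x s" "y s"] M(2)[OF that] M(3)[OF that] by linarith
  have "absolutely_continuous_on_interval t0 t g"
  proof (rule absolutely_continuous_on_interval_dominated[OF acx acy])
    fix u v assume uv: "t0 \<le> u" "u \<le> v" "v \<le> t"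
    have "0 \<le> 2 * c * (u - t0)" "2 * c * (u - t0) \<le> 2 * c * (v - t0)" "0 \<le> 2 * c * (v - t0)"
      using uv by (auto simp: c_def intro: mult_left_mono)
    then have E: "0 \<le> E v" "E v \<le> 1" "\<bar>E v - E u\<bar> \<le> 2 * c * (v - u)"
      using exp_neg_lipschitz[of "2 * c * (u - t0)" "2 * c * (v - t0)"]
      by (simp_all add: E_def right_diff_distrib)
    have "\<bar>inner (w v) (w v) - inner (w u) (w u)\<bar> = \<bar>inner (w v + w u) (w v - w u)\<bar>"
      by (simp add: inner_add inner_diff inner_commute)
    also have "\<dots> \<le> norm (w v + w u) * norm (w v - w u)" by (rule Cauchy_Schwarz_ineq2)
    also have "\<dots> \<le> (4 * M) * (norm (x v - x u) + norm (y v - y u))"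
    proof (intro mult_mono)
      show "norm (w v + w u) \<le> 4 * M"
        using norm_triangle_ineq[of "w v" "w u"] w[of u] w[of v] uv by auto
      have "w v - w u = (x v - x u) - (y v - y u)" by (simp add: w_def)
      then show "norm (w v - w u) \<le> norm (x v - x u) + norm (y v - y u)"
        by (simp only: norm_triangle_ineq4)
    qed (use M in auto)
    finally have W: "\<bar>inner (w v) (w v) - inner (w u) (w u)\<bar> \<le> (4 * M) * (norm (x v - x u) + norm (y v - y u))" .
    have Wu: "inner (w u) (w u) \<le> (2 * M)\<^sup>2"
      using power_mono[OF w[of u], of 2] uv by (simp add: dot_square_norm)
    \<comment> \<open>Discrete product rule: the increment of \<open>g\<close> splits into
      increments of the squared distance and of the weight.\<close>
    have "norm (g v - g u) = \<bar>E v * (inner (w v) (w v) - inner (w u) (w u)) + inner (w u) (w u) * (E v - E u)\<bar>"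
      by (simp add: g_def algebra_simps)
    also have "\<dots> \<le> E v * \<bar>inner (w v) (w v) - inner (w u) (w u)\<bar> + inner (w u) (w u) * \<bar>E v - E u\<bar>"
      using E(1) by (intro order_trans[OF abs_triangle_ineq]) (simp add: abs_mult)
    also have "\<dots> \<le> 1 * ((4 * M) * (norm (x v - x u) + norm (y v - y u))) + (2 * M)\<^sup>2 * (2 * c * (v - u))"
      using E W Wu by (intro add_mono mult_mono) auto
    finally show "norm (g v - g u) \<le> (4 * M) * (norm (x v - x u) + norm (y v - y u)) + ((2 * M)\<^sup>2 * (2 * c)) * (v - u)"
      by (simp add: mult.assoc)
  qed (use M in \<open>auto simp: c_def\<close>)
  moreover obtain N1 N2 where N: "negligible N1" "negligible N2"
    "\<And>s. s \<in> {t0..T} - N1 \<Longrightarrow> \<exists>v. (x has_vector_derivative v) (at s within {t0..T}) \<and> v \<in> F s (x s)"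
    "\<And>s. s \<in> {t0..T} - N2 \<Longrightarrow> \<exists>v. (y has_vector_derivative v) (at s within {t0..T}) \<and> v \<in> F s (y s)"
    using x y unfolding inclusion_solution_def by (auto simp: AE_lebesgue_on_iff_negligible)
  moreover have "\<exists>D\<le>0. (g has_real_derivative D) (at s within {t0..t})" if s: "s \<in> {t0..t} - (N1 \<union> N2)" for s
  proof -
    have sT: "s \<in> {t0..T}" "{t0..t} \<subseteq> {t0..T}" using s t by auto
    obtain v1 v2 where v1: "(x has_vector_derivative v1) (at s within {t0..T})" "v1 \<in> F s (x s)"
      and v2: "(y has_vector_derivative v2) (at s within {t0..T})" "v2 \<in> F s (y s)"
      using N(3)[of s] N(4)[of s] s sT by blast
    have dw: "(w has_vector_derivative v1 - v2) (at s within {t0..t})"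
      unfolding w_def using v1(1) v2(1) sT(2)
      by (intro has_vector_derivative_diff) (auto intro: has_vector_derivative_within_subset)
    have "((\<lambda>s. inner (w s) (w s)) has_real_derivative inner (w s) (v1 - v2) + inner (v1 - v2) (w s)) (at s within {t0..t})"
      using bounded_bilinear.has_vector_derivative[OF bounded_bilinear_inner dw dw]
      by (simp add: has_real_derivative_iff_has_vector_derivative)
    moreover have "(E has_real_derivative - (2 * c) * E s) (at s within {t0..t})"
      unfolding E_def by (auto intro!: derivative_eq_intros)
    ultimately have "(g has_real_derivative - (2 * c) * E s * inner (w s) (w s)
        + (inner (w s) (v1 - v2) + inner (v1 - v2) (w s)) * E s) (at s within {t0..t})"
      unfolding g_def by (rule DERIV_mult[rotated])
    moreover have "inner (v1 - v2) (w s) \<le> c0 * inner (w s) (w s)"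
      unfolding w_def using c0[OF sT(1) M(2,3) v1(2) v2(2)] s by (simp add: dot_square_norm)
    then have "inner (v1 - v2) (w s) \<le> c * inner (w s) (w s)"
      using mult_right_mono[OF abs_ge_self[of c0], of "inner (w s) (w s)"] by (simp add: c_def)
    then have "E s * inner (v1 - v2) (w s) \<le> E s * (c * inner (w s) (w s))"
      by (intro mult_left_mono) (auto simp: E_def)
    then have "- (2 * c) * E s * inner (w s) (w s)
        + (inner (w s) (v1 - v2) + inner (v1 - v2) (w s)) * E s \<le> 0"
      by (simp add: inner_commute algebra_simps)
    ultimately show ?thesis by blast
  qed
  ultimately have "g t \<le> g t0"
    using t by (intro absolutely_continuous_nonincreasing[of t0 t g "N1 \<union> N2"]) auto
  moreover have "g t0 = 0" using x y by (simp add: g_def w_def inclusion_solution_def)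
  ultimately have "inner (w t) (w t) \<le> 0" by (simp add: g_def E_def mult_le_0_iff)
  then show ?thesis by (metis inner_gt_zero_iff not_less eq_iff_diff_eq_0 w_def)
qed

text \<open>Clamping the argument to the interval extends \<open>x\<close> to the whole line with
  the same Lipschitz constant, which makes almost everywhere differentiability available.\<close>

lemma inclusion_solution_of_lipschitz:
  fixes x :: "real \<Rightarrow> 'a::euclidean_space"
  assumes lip: "K-lipschitz_on {a..b} x" and "x a = x0"
    and deriv: "\<And>t v. t \<in> {a<..<b} \<Longrightarrow> (x has_vector_derivative v) (at t) \<Longrightarrow> v \<in> F t (x t)"
  shows "inclusion_solution F a b x0 x"
proof -
  define X where "X t = x (max a (min b t))" for t
  have "K-lipschitz_on UNIV X" if "a \<le> b"
  proof (rule lipschitz_onI)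
    fix s t
    have "dist (X s) (X t) \<le> K * dist (max a (min b s)) (max a (min b t))"
      unfolding X_def using that by (intro lipschitz_onD[OF lip]) auto
    also have "\<dots> \<le> K * dist s t"
      using lipschitz_on_nonneg[OF lip] by (intro mult_left_mono) (auto simp: dist_real_def)
    finally show "dist (X s) (X t) \<le> K * dist s t" .
  qed (use lip lipschitz_on_nonneg in auto)
  \<comment> \<open>Without the endpoints, the clamped curve and \<open>x\<close> agree near
    \<open>t\<close>, so \<open>x\<close> has a two-sided derivative there.\<close>
  define N where "N = {t. \<not> X differentiable (at t)} \<union> {a, b}"
  have "\<exists>v. (x has_vector_derivative v) (at t within {a..b}) \<and> v \<in> F t (x t)" if t: "t \<in> {a..b} - N" for t
  proof -
    have t': "t \<in> {a<..<b}" using t by (auto simp: N_def)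
    from t obtain v where "(X has_vector_derivative v) (at t)"
      by (auto simp: N_def vector_derivative_works)
    then have v: "(x has_vector_derivative v) (at t)"
      by (rule has_vector_derivative_transform_within_open[OF _ open_greaterThanLessThan t']) (auto simp: X_def)
    then show ?thesis using deriv[OF t'] has_vector_derivative_at_within by blast
  qed
  moreover have "negligible N" if "a \<le> b"
    unfolding N_def using negligible_not_differentiable_lipschitz \<open>a \<le> b \<Longrightarrow> K-lipschitz_on UNIV X\<close> that by auto
  ultimately have "AE t in lebesgue_on {a..b}. \<exists>v. (x has_vector_derivative v) (at t within {a..b}) \<and> v \<in> F t (x t)"
    by (cases "a \<le> b") (auto simp: AE_lebesgue_on_iff_negligible)
  with assms show ?thesis
    by (simp add: inclusion_solution_def absolutely_continuous_on_interval_lipschitz)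
qed

section \<open>The state-dependent sweeping process\<close>

theorem theorem5p1:
  fixes T L1 L2 cf :: real
    and C :: "real \<Rightarrow> real ^ 'n \<Rightarrow> (real ^ 'n) set"
    and f :: "real \<Rightarrow> real ^ 'n \<Rightarrow> real ^ 'n"
  assumes T_pos: "T > 0"
    and C_values: "\<And>t x. t \<in> {0..T} \<Longrightarrow> C t x \<noteq> {} \<and> closed (C t x) \<and> convex (C t x)"
    and L1: "L1 \<ge> 0"
    and L2: "0 \<le> L2" "L2 < 1"
    and C_lipschitz: "\<And>t s x y. t \<in> {0..T} \<Longrightarrow> s \<in> {0..T} \<Longrightarrow>
          hausdorff_dist (C t x) (C s y) \<le> ereal (L1 * \<bar>t - s\<bar> + L2 * norm (x - y))"
    and f_cont: "continuous_on ({0..T} \<times> UNIV) (\<lambda>(t, x). f t x)"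
    and cf: "cf > 0"
    and f_growth: "\<And>t x. t \<in> {0..T} \<Longrightarrow> norm (f t x) \<le> cf * (1 + norm x)"
    and local_bounds: "\<And>M. M > 0 \<Longrightarrow> \<exists>k>0. \<exists>l>0. \<forall>t\<in>{0..T}. \<forall>x1 x2.
          norm x1 \<le> M \<longrightarrow> norm x2 \<le> M \<longrightarrow>
            (\<forall>z1\<in>normal_cone (C t x1) x1. \<forall>z2\<in>normal_cone (C t x2) x2.
               inner (z1 - z2) (x1 - x2) \<ge> - k * (norm (x1 - x2))\<^sup>2) \<and>
            norm (f t x1 - f t x2) \<le> l * norm (x1 - x2)"
  shows "\<forall>t0\<in>{0..T}. \<forall>x0. x0 \<in> C t0 x0 \<longrightarrow>
           (let sol = inclusion_solution
                        (\<lambda>t x. (\<lambda>z. f t x - z) ` normal_cone (C t x) x) t0 T x0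
            in (\<exists>x. sol x) \<and>
               (\<forall>x y. sol x \<longrightarrow> sol y \<longrightarrow> (\<forall>t\<in>{t0..T}. x t = y t)))"
proof (intro ballI allI impI)
  fix t0 x0 assume t0: "t0 \<in> {0..T}" and x0: "x0 \<in> C t0 x0"
  define F where "F t x = (\<lambda>z. f t x - z) ` normal_cone (C t x) x" for t x
  have K: "\<And>x. closed (C t x)" "\<And>x. C t x \<noteq> {}" "\<And>x. convex (C t x)" if "t \<in> {0..T}" for t
    using C_values that by auto
  have H: "hausdorff_dist (C t x) (C t y) \<le> ereal (L2 * norm (x - y))" if "t \<in> {0..T}" for t x y
    using C_lipschitz[OF that that, of x y] by simp
  have mn: "monotone_normals (C t)" if t: "t \<in> {0..T}" for t
  proof
    fix x1 x2 z1 z2 assume z: "z1 \<in> normal_cone (C t x1) x1" "z2 \<in> normal_cone (C t x2) x2"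
    \<comment> \<open>The constant \<open>k\<close> depends on the radius, but any two points fit in
      some ball and scaling removes \<open>k\<close>; so monotonicity is global.\<close>
    have "norm x1 + norm x2 + 1 > 0" by (simp add: add_nonneg_pos)
    then obtain k where "\<And>z1 z2. z1 \<in> normal_cone (C t x1) x1 \<Longrightarrow> z2 \<in> normal_cone (C t x2) x2 \<Longrightarrow>
        inner (z1 - z2) (x1 - x2) \<ge> - k * (norm (x1 - x2))\<^sup>2"
      using local_bounds[of "norm x1 + norm x2 + 1"] t
      by (metis (no_types, lifting) add_increasing add_increasing2 norm_ge_zero order_refl zero_le_one)
    then show "inner (z1 - z2) (x1 - x2) \<ge> 0"
      using z by (rule monotone_normal_cone_if_hypomonotone)
  next
    fix y show "\<exists>p. y - p \<in> normal_cone (C t p) p"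
      using exists_implicit_projection[OF K[OF t] H[OF t] L2] by metis
  qed
  have uniq: "x t = y t" if "inclusion_solution F t0 T x0 x" "inclusion_solution F t0 T x0 y" "t \<in> {t0..T}" for x y t
  proof (rule inclusion_solution_unique[OF that(1,2) _ that(3)])
    fix M :: real
    \<comment> \<open>The bounds are available for positive radii only, while \<open>M\<close> is
      arbitrary here.\<close>
    have "\<bar>M\<bar> + 1 > 0" by simp
    then obtain l where l: "\<And>t x1 x2. t \<in> {0..T} \<Longrightarrow> norm x1 \<le> \<bar>M\<bar> + 1 \<Longrightarrow> norm x2 \<le> \<bar>M\<bar> + 1 \<Longrightarrow>
        norm (f t x1 - f t x2) \<le> l * norm (x1 - x2)"
      using local_bounds by meson
    have "inner (v1 - v2) (x1 - x2) \<le> l * (norm (x1 - x2))\<^sup>2"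
      if t: "t \<in> {t0..T}" and x: "norm x1 \<le> M" "norm x2 \<le> M" and v: "v1 \<in> F t x1" "v2 \<in> F t x2" for t x1 x2 v1 v2
    proof -
      have t': "t \<in> {0..T}" using t t0 by auto
      obtain z1 z2 where z: "z1 \<in> normal_cone (C t x1) x1" "z2 \<in> normal_cone (C t x2) x2"
        "v1 = f t x1 - z1" "v2 = f t x2 - z2" using v by (auto simp: F_def)
      have "inner (f t x1 - f t x2) (x1 - x2) \<le> norm (f t x1 - f t x2) * norm (x1 - x2)"
        by (rule norm_cauchy_schwarz)
      also have "\<dots> \<le> (l * norm (x1 - x2)) * norm (x1 - x2)"
        using x by (intro mult_right_mono l[OF t']) auto
      moreover have "0 \<le> inner (z1 - z2) (x1 - x2)"
        using monotone_normals.monotone[OF mn[OF t'] z(1,2)] .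
      ultimately show ?thesis
        by (simp add: z(3,4) inner_diff_left power2_eq_square mult.assoc)
    qed
    then show "\<exists>c. \<forall>t\<in>{t0..T}. \<forall>x1 x2 v1 v2. norm x1 \<le> M \<longrightarrow> norm x2 \<le> M \<longrightarrow>
        v1 \<in> F t x1 \<longrightarrow> v2 \<in> F t x2 \<longrightarrow> inner (v1 - v2) (x1 - x2) \<le> c * (norm (x1 - x2))\<^sup>2"
      by blast
  qed
  have ex: "\<exists>x. inclusion_solution F t0 T x0 x"
  proof (cases "t0 = T")
    case True
    \<comment> \<open>On a degenerate interval the open interval is empty and a constant curve is a
      solution.\<close>
    have "inclusion_solution F t0 T x0 (\<lambda>_. x0)"
      using True by (intro inclusion_solution_of_lipschitz[of 0]) (auto intro: lipschitz_onI)
    then show ?thesis by blast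
  next
    case False
    interpret sweeping_process "\<lambda>t. fixed_set (C t)" f t0 T "L1 / (1 - L2)" cf x0
    proof
      show "t0 < T" using False t0 by auto
      show "closed (fixed_set (C t))" "convex (fixed_set (C t))" "fixed_set (C t) \<noteq> {}" if "t \<in> {t0..T}" for t
        using monotone_normals.closed_fixed_set[OF mn, of t] monotone_normals.convex_fixed_set[OF mn, of t]
          monotone_normals.fixed_set_nonempty[OF mn, of t] that t0 by auto
      show "0 \<le> L1 / (1 - L2)" using L1 L2 by simp
      show "\<exists>y\<in>fixed_set (C t). dist x y \<le> L1 / (1 - L2) * \<bar>s - t\<bar>"
        if st: "s \<in> {t0..T}" "t \<in> {t0..T}" and x: "x \<in> fixed_set (C s)" for s t x
      proof -
        have st': "s \<in> {0..T}" "t \<in> {0..T}" using st t0 by auto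
        obtain p where p: "p \<in> C t p" "norm (x - p) \<le> infdist x (C t x) / (1 - L2)"
          using exists_implicit_projection[OF K[OF st'(2)] H[OF st'(2)] L2, of x] by metis
        \<comment> \<open>The state is \<open>x\<close> in both sets, so the \<open>L2\<close> term
          vanishes and only the time difference remains.\<close>
        have "infdist x (C t x) \<le> L1 * \<bar>s - t\<bar>"
          using C_lipschitz[OF st', of x x] x by (auto simp: hausdorff_dist_le_ereal_iff fixed_set_def)
        then have "infdist x (C t x) / (1 - L2) \<le> L1 * \<bar>s - t\<bar> / (1 - L2)"
          using L2 by (intro divide_right_mono) auto
        then show ?thesis using p by (intro bexI[of _ p]) (auto simp: fixed_set_def dist_norm)
      qed
      show "continuous_on ({t0..T} \<times> UNIV) (\<lambda>(t, x). f t x)"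
        by (rule continuous_on_subset[OF f_cont]) (use t0 in auto)
      show "norm (f t x) \<le> cf * (1 + norm x)" if "t \<in> {t0..T}" for t x
        using that t0 by (intro f_growth) auto
    qed (use cf x0 in \<open>auto simp: fixed_set_def\<close>)
    obtain x where x: "speed-lipschitz_on {t0..T} x" "x t0 = x0" "\<And>t. t \<in> {t0..T} \<Longrightarrow> x t \<in> fixed_set (C t)"
      "\<And>t v z. t \<in> {t0<..<T} \<Longrightarrow> (x has_vector_derivative v) (at t) \<Longrightarrow> z \<in> fixed_set (C t) \<Longrightarrow>
        inner (f t (x t) - v) (z - x t) \<le> 0"
      using solution_exists by blast
    have "v \<in> F t (x t)" if t: "t \<in> {t0<..<T}" and v: "(x has_vector_derivative v) (at t)" for t v
    proof -
      \<comment> \<open>The inequality over the fixed set is translated back into normality to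
        \<open>C t (x t)\<close>.\<close>
      have "f t (x t) - v \<in> normal_cone (C t (x t)) (x t)"
        using monotone_normals.normal_cone_iff[OF mn x(3)] x(4)[OF t v] t t0 by auto
      then show ?thesis unfolding F_def by (rule rev_image_eqI) simp
    qed
    then have "inclusion_solution F t0 T x0 x"
      using x(1,2) by (intro inclusion_solution_of_lipschitz) auto
    then show ?thesis by blast
  qed
  show "let sol = inclusion_solution (\<lambda>t x. (\<lambda>z. f t x - z) ` normal_cone (C t x) x) t0 T x0
      in (\<exists>x. sol x) \<and> (\<forall>x y. sol x \<longrightarrow> sol y \<longrightarrow> (\<forall>t\<in>{t0..T}. x t = y t))"
    using ex uniq unfolding F_def[abs_def] Let_def by blast
qed

end
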